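(* Let $T>0$ be finite, let $M\ge 1$ be an integer, $0<\nu_M<\dots<\nu_1<\nu_0<1$, and let $\mathbf{D}_t$ be the fractional differential operator of type II, $$\mathbf{D}_t v(t)=\sum_{i=0}^{M}\mathbf{D}_t^{\nu_i}(r_iv)(t).$$ Assume that there exist a positive time $T^*\le T$ and some $\nu^*\in(0,1)$ such that: (1) $v\in\mathcal{C}([0,T])$ and $\mathbf{D}_t^{\nu_i}v\in\mathcal{C}([0,T])$ for $i=0,1,\dots,M$; moreover $v\in\mathcal{C}^{\nu^*}_{\nu_0}([0,T^*])$ and $\mathbf{D}_t^{\nu_i}v\in\mathcal{C}^{\nu^*}([0,T^*])$ for $i=0,1,\dots,M$; (2) $r_0,\dots,r_M$ are continuous on $[0,T]$, $r_0(t)\neq0$ for all $t\in[0,T]$, and each $r_i$ has one of the following regularities: (i) either $r_i\in\mathcal{C}^1([0,T^*])$; (ii) or, if $\nu^*+\nu_i<1$, then $r_i\in\mathcal{C}^{\mu_i}([0,T^*])\cap\mathcal{C}_{\nu_i}^{\mu^*}([0,T^*])$ for some $\mu_i\in(\nu^*+\nu_i,1)$ and $\mu^*\in(0,1)$; (iii) or, if $1\le\nu^*+\nu_i<2$, then $r_i\in\mathcal{C}^{\mu^*}_{\mu_i}([0,T^*])$ and $\mathbf{D}_t^{\nu_i}r_i\in\mathcal{C}^{\mu_1^*}([0,T^*])$ with some $\mu_i\in(\nu_i,1)$ and $\mu^*,\mu_1^*\in(0,1)$. If, additionally, $$\mathbf{D}_tv|_{t=0}-v(0)\sum_{i=1}^{M}\mathbf{D}_t^{\nu_i}r_i(0)\neq0,$$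 then $$\nu_0=\lim_{t\to 0}\frac{t[r_0(t)v(t)-r_0(0)v(0)]}{\int_0^t[r_0(\tau)v(\tau)-r_0(0)v(0)]\,d\tau}-1,$$ and, besides, for all $t\in[0,T^*]$, $$r_0(t)v(t)=r_0(0)v(0)+\mathfrak{C}_1t^{\nu_0}+\frac{1}{\Gamma(\nu_0)}\int_0^t(t-\tau)^{\nu_0-1}\big[\mathbf{D}_\tau^{\nu_0}(r_0v)(\tau)-\mathbf{D}_\tau^{\nu_0}(r_0v)(0)\big]d\tau$$ with $$\mathfrak{C}_1=\frac{\mathbf{D}_tv|_{t=0}-v(0)\sum_{i=1}^{M}\mathbf{D}_t^{\nu_i}r_i(0)}{\Gamma(1+\nu_0)}.$$
   Context: All functions are real-valued and limits $t\to0$ are one-sided ($t>0$). For $\nu\in(0,1)$ the regularized (left) Caputo derivative is $$\mathbf{D}_t^{\nu}v(t)=\frac{1}{\Gamma(1-\nu)}\frac{d}{dt}\int_0^t\frac{v(s)-v(0)}{(t-s)^{\nu}}\,ds,$$ where $\Gamma$ is the Euler Gamma-function. When $\mathbf{D}_t^\nu v$ is said to be continuous on a closed interval $[0,T]$, its value at $t=0$ is the continuous extension (limit as $t\to0$). $\mathcal{C}([0,T])$ is the space of continuous functions, $\mathcal{C}^{\alpha}([0,T])$, $\alpha\in(0,1)$, the usual Hölder space with seminorm $\langle\cdot\rangle^{(\alpha)}_{t,[0,T]}$, $\mathcal{C}^1$ the continuously differentiable functions. For $\nu,\alpha\in(0,1)$, $\mathcal{C}^{\alpha}_{\nu}([0,T])$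 is the space of continuous $v$ with $\mathbf{D}_t^\nu v$ continuous on $[0,T]$ and finite norm $$\|v\|_{\mathcal{C}^{\alpha}_{\nu}([0,T])}=\|v\|_{\mathcal{C}([0,T])}+\|\mathbf{D}_t^{\nu}v\|_{\mathcal{C}([0,T])}+\langle\mathbf{D}_t^{\nu}v\rangle^{(\alpha)}_{t,[0,T]}.$$ *)

theory Defs
  imports "HOL-Analysis.Analysis"
begin

(* Functions on [0,b] are total functions on the reals of which only the values on [0,b]
   matter; hence all derivatives are taken within [0,b], i.e. one-sided at the endpoints. *)

definition caputo_integral :: "real \<Rightarrow> (real \<Rightarrow> real) \<Rightarrow> real \<Rightarrow> real" where
  "caputo_integral \<nu> v t = integral {0..t} (\<lambda>s. (v s - v 0) / (t - s) powr \<nu>)"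

(* The formula for the regularized Caputo derivative; it is meaningful for 0 < t \<le> b only. *)
definition caputo_pos :: "real \<Rightarrow> real \<Rightarrow> (real \<Rightarrow> real) \<Rightarrow> real \<Rightarrow> real" where
  "caputo_pos b \<nu> v t =
     1 / Gamma (1 - \<nu>) * vector_derivative (caputo_integral \<nu> v) (at t within {0..b})"

(* Regularized Caputo derivative of order \<nu> on [0,b]; its value at 0 is the limit from the right. *)
definition caputo :: "real \<Rightarrow> real \<Rightarrow> (real \<Rightarrow> real) \<Rightarrow> real \<Rightarrow> real" where
  "caputo b \<nu> v t = (if t = 0 then Lim (at_right 0) (caputo_pos b \<nu> v) else caputo_pos b \<nu> v t)"

(* The Caputo derivative exists and is continuous on [0,b]. Continuity at 0 forces the limit
   defining caputo at 0 to exist. *)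
definition caputo_continuous :: "real \<Rightarrow> real \<Rightarrow> (real \<Rightarrow> real) \<Rightarrow> bool" where
  "caputo_continuous b \<nu> v \<longleftrightarrow>
     (\<forall>t\<in>{0<..b}. caputo_integral \<nu> v differentiable (at t within {0..b})) \<and>
     continuous_on {0..b} (caputo b \<nu> v)"

definition C1_on :: "real \<Rightarrow> (real \<Rightarrow> real) \<Rightarrow> bool" where
  "C1_on b f \<longleftrightarrow>
     (\<exists>f'. (\<forall>t\<in>{0..b}. (f has_real_derivative f' t) (at t within {0..b})) \<and>
           continuous_on {0..b} f')"

definition holder_on :: "real \<Rightarrow> real \<Rightarrow> (real \<Rightarrow> real) \<Rightarrow> bool" where
  "holder_on b \<alpha> f \<longleftrightarrow>
     (\<exists>L. \<forall>s\<in>{0..b}. \<forall>t\<in>{0..b}. \<bar>f t - f s\<bar> \<le> L * \<bar>t - s\<bar> powr \<alpha>)"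

(* The space C^\<alpha>_\<nu>([0,b]). The two sup-norms in its norm are finite by continuity on the
   compact interval, so finiteness of the norm is finiteness of the Hoelder seminorm. *)
definition caputo_holder :: "real \<Rightarrow> real \<Rightarrow> real \<Rightarrow> (real \<Rightarrow> real) \<Rightarrow> bool" where
  "caputo_holder b \<nu> \<alpha> v \<longleftrightarrow>
     continuous_on {0..b} v \<and> caputo_continuous b \<nu> v \<and> holder_on b \<alpha> (caputo b \<nu> v)"

(* Fractional differential operator of type II: the coefficients are inside the derivatives. *)
definition frac_op_II ::
    "real \<Rightarrow> nat \<Rightarrow> (nat \<Rightarrow> real) \<Rightarrow> (nat \<Rightarrow> real \<Rightarrow> real) \<Rightarrow> (real \<Rightarrow> real) \<Rightarrow> real \<Rightarrow> real" where
  "frac_op_II b M \<nu> r v t = (\<Sum>i=0..M. caputo b (\<nu> i) (\<lambda>s. r i s * v s) t)"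

end

theory Submission
  imports Defs
begin

text \<open>
  Let \<open>I\<^sup>a\<close> be the Riemann--Liouville integral of order \<open>a\<close>. The semigroup law \<open>I\<^sup>a I\<^sup>b = I\<^sup>a\<^sup>+\<^sup>b\<close> shows that
  \<open>w\<close> has a continuous Caputo derivative \<open>\<phi>\<close> of order \<open>\<theta>\<close> iff \<open>w - w 0 = I\<^sup>\<theta> \<phi>\<close>. If \<open>r\<close> is Hoelder
  continuous of an exponent larger than \<open>\<theta>\<close>, the product \<open>r v\<close> therefore has the continuous
  Caputo derivative \<open>r D\<^sup>\<theta>v + v(0) D\<^sup>\<theta>r + E\<close>, where
  \<open>E(t) = \<theta>/\<Gamma>(1-\<theta>) \<integral>\<^sub>0\<^sup>t (v(s) - v(0)) (r(t) - r(s)) (t-s)\<^sup>-\<^sup>\<theta>\<^sup>-\<^sup>1 ds\<close> vanishes at \<open>0\<close>; each of the three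
  regularity classes for \<open>r\<^sub>i\<close> gives such an exponent. The lower order derivatives of \<open>v\<close> vanish
  at \<open>0\<close>, so the nonzero quantity of the hypothesis is \<open>\<Phi>(0)\<close> with \<open>\<Phi> = D\<^sup>\<nu>\<^sup>0(r\<^sub>0v)\<close>. The representation is
  \<open>r\<^sub>0v - r\<^sub>0v(0) = I\<^sup>\<nu>\<^sup>0 \<Phi>\<close> with \<open>\<Phi>(0)\<close> split off, and the limit follows from
  \<open>I\<^sup>a \<Phi>(t) \<sim> \<Phi>(0) t\<^sup>a / \<Gamma>(1+a)\<close> for \<open>a = \<nu>\<^sub>0\<close> and \<open>a = 1 + \<nu>\<^sub>0\<close>.
\<close>

subsection \<open>Riemann--Liouville integrals\<close>

lemma has_integral_reflect_shift:
  fixes f :: "real \<Rightarrow> 'a::banach"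
  assumes "(f has_integral I) {a..b}"
  shows "((\<lambda>x. f (c - x)) has_integral I) {c - b..c - a}"
proof -
  have "((\<lambda>x. f (- x)) has_integral I) {- b..- a}"
    using assms by simp
  then have "((\<lambda>x. f (- (1 *\<^sub>R x + - c))) has_integral (I /\<^sub>R 1 ^ DIM(real))) 
      (cbox ((- b - - c) /\<^sub>R 1) ((- a - - c) /\<^sub>R 1))"
    unfolding cbox_interval[symmetric] by (rule has_integral_affinity') simp
  then show ?thesis by (simp add: algebra_simps)
qed

text \<open>Integrability need not be assumed: the reflection is an involution, so either both
  integrands are integrable or neither is, and then both integrals have the default value 0.\<close>

lemma integral_reflect_shift:
  fixes f :: "real \<Rightarrow> 'a::banach"
  shows "integral {0..t} (\<lambda>x. f (t - x)) = integral {0..t} f"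
proof (cases "f integrable_on {0..t}")
  case True
  then show ?thesis
    using has_integral_reflect_shift[OF integrable_integral[OF True], of t] by (simp add: integral_unique)
next
  case False
  have "\<not> (\<lambda>x. f (t - x)) integrable_on {0..t}"
  proof
    assume "(\<lambda>x. f (t - x)) integrable_on {0..t}"
    from has_integral_reflect_shift[OF integrable_integral[OF this], of t] False
    show False by (auto simp: integrable_on_def)
  qed
  then show ?thesis using False by (simp add: not_integrable_integral)
qed

section \<open>The weakly singular kernel against continuous functions\<close>

lemma has_integral_powr_diff:
  fixes a c t :: real
  assumes "0 < a" "c \<le> t"
  shows "((\<lambda>s. (t - s) powr (a - 1)) has_integral (t - c) powr a / a) {c..t}"
proof -
  have "((\<lambda>x. x powr (a - 1)) has_integral ((t - c) powr (a - 1 + 1) / (a - 1 + 1))) {0..t - c}"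
    using assms by (intro has_integral_powr_from_0) auto
  from has_integral_reflect_shift[OF this, of t] show ?thesis by simp
qed

lemma absolutely_integrable_powr_diff:
  fixes a c t :: real
  assumes "0 < a"
  shows "(\<lambda>s. (t - s) powr (a - 1)) absolutely_integrable_on {c..t}"
proof (cases "c \<le> t")
  case True
  then show ?thesis
    using has_integral_powr_diff[OF assms True]
    by (intro nonnegative_absolutely_integrable_1) auto
qed simp

lemma absolutely_integrable_kernel_mult:
  fixes a c t :: real
  assumes "0 < a" "continuous_on {c..t} f"
  shows "(\<lambda>s. (t - s) powr (a - 1) * f s) absolutely_integrable_on {c..t}"
proof -
  have "(\<lambda>s. f s * (t - s) powr (a - 1)) absolutely_integrable_on {c..t}"
    using assms
    by (intro absolutely_integrable_bounded_measurable_product_real absolutely_integrable_powr_diff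
        continuous_imp_measurable_on_sets_lebesgue compact_imp_bounded compact_continuous_image) auto
  then show ?thesis by (simp add: mult.commute)
qed

lemmas kernel_mult_integrable =
  set_lebesgue_integral_eq_integral(1)[OF absolutely_integrable_kernel_mult]

lemma abs_integral_kernel_le:
  fixes a c t :: real
  assumes "0 < a" "c \<le> t" "continuous_on {c..t} f" "\<And>s. s \<in> {c..t} \<Longrightarrow> \<bar>f s\<bar> \<le> B"
  shows "\<bar>integral {c..t} (\<lambda>s. (t - s) powr (a - 1) * f s)\<bar> \<le> B * (t - c) powr a / a"
proof -
  have "((\<lambda>s. B * (t - s) powr (a - 1)) has_integral B * ((t - c) powr a / a)) {c..t}"
    using has_integral_powr_diff assms by (intro has_integral_mult_right) auto
  moreover have "norm (integral {c..t} (\<lambda>s. (t - s) powr (a - 1) * f s))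
      \<le> integral {c..t} (\<lambda>s. B * (t - s) powr (a - 1))"
    using assms calculation
    by (intro integral_norm_bound_integral kernel_mult_integrable)
       (auto simp: abs_mult mult.commute intro!: mult_right_mono)
  ultimately show ?thesis unfolding real_norm_def by (metis integral_unique times_divide_eq_right)
qed

section \<open>The fractional integral operator and its elementary rules\<close>

definition frac_integral :: "real \<Rightarrow> (real \<Rightarrow> real) \<Rightarrow> real \<Rightarrow> real" where
  "frac_integral a f t = integral {0..t} (\<lambda>s. (t - s) powr (a - 1) * f s) / Gamma a"

lemma frac_integral_0 [simp]: "frac_integral a f 0 = 0"
  by (simp add: frac_integral_def)

lemma frac_integral_cong:
  "(\<And>s. s \<in> {0..t} \<Longrightarrow> f s = g s) \<Longrightarrow> frac_integral a f t = frac_integral a g t"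
  unfolding frac_integral_def by (intro arg_cong2[where f="(/)"] integral_cong) auto

lemma frac_integral_1: "frac_integral 1 f t = integral {0..t} f"
proof -
  \<comment> \<open>In HOL \<open>0 powr 0\<close> is 0, so the kernel of order 1 differs from 1 at
    s = t; a single point does not affect the integral.\<close>
  have "integral {0..t} (\<lambda>s. (t - s) powr 0 * f s) = integral {0..t} f"
    by (rule integral_spike[of "{t}"]) auto
  then show ?thesis by (simp add: frac_integral_def)
qed

lemma frac_integral_diff:
  assumes "0 < a" "continuous_on {0..t} f" "continuous_on {0..t} g"
  shows "frac_integral a (\<lambda>s. f s - g s) t = frac_integral a f t - frac_integral a g t"
  using integral_diff[OF kernel_mult_integrable kernel_mult_integrable, OF assms(1,2) assms(1,3)]
  by (simp add: frac_integral_def diff_divide_distrib right_diff_distrib)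

lemma frac_integral_plus:
  assumes "0 < a" "continuous_on {0..t} f" "continuous_on {0..t} g"
  shows "frac_integral a (\<lambda>s. f s + g s) t = frac_integral a f t + frac_integral a g t"
  using integral_add[OF kernel_mult_integrable kernel_mult_integrable, OF assms(1,2) assms(1,3)]
  by (simp add: frac_integral_def add_divide_distrib distrib_left)

lemma frac_integral_mult_right: "frac_integral a (\<lambda>s. c * f s) t = c * frac_integral a f t"
  by (simp add: frac_integral_def mult.left_commute[of _ c])

lemma frac_integral_const:
  assumes "0 < a" "0 \<le> t"
  shows "frac_integral a (\<lambda>_. k) t = k * t powr a / Gamma (1 + a)"
proof -
  have "a * Gamma a = Gamma (1 + a)"
    using assms Gamma_plus1[of a] by (auto simp: add.commute nonpos_Ints_def)
  moreover have "integral {0..t} (\<lambda>s. (t - s) powr (a - 1) * k) = t powr a / a * k"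
    using has_integral_mult_left[OF has_integral_powr_diff[of a 0 t], of k] assms
    by (intro integral_unique) simp
  ultimately show ?thesis by (simp add: frac_integral_def mult.commute)
qed

lemma abs_frac_integral_le:
  assumes "0 < a" "0 \<le> t" "continuous_on {0..t} f" "\<And>s. s \<in> {0..t} \<Longrightarrow> \<bar>f s\<bar> \<le> B"
  shows "\<bar>frac_integral a f t\<bar> \<le> B * t powr a / Gamma (1 + a)"
proof -
  have "a * Gamma a = Gamma (1 + a)"
    using assms Gamma_plus1[of a] by (auto simp: add.commute nonpos_Ints_def)
  moreover have "\<bar>frac_integral a f t\<bar> \<le> (B * t powr a / a) / Gamma a"
    using divide_right_mono[OF abs_integral_kernel_le[OF assms], of "Gamma a"] Gamma_real_pos[OF assms(1)]
    by (simp add: frac_integral_def)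
  ultimately show ?thesis by (metis divide_divide_eq_left)
qed

section \<open>Hoelder continuity of fractional integrals\<close>

text \<open>Split at s. On [s, t] the kernel has mass (t - s)^a / a. On [0, s] the difference of the
  two kernels has constant sign because a \<le> 1, so its mass is a difference of explicit masses,
  again at most (t - s)^a / a. The two contributions give the factor 2.\<close>

lemma frac_integral_holder:
  assumes a: "0 < a" "a \<le> 1" and st: "0 \<le> s" "s \<le> t"
    and f: "continuous_on {0..t} f" and B: "\<And>x. x \<in> {0..t} \<Longrightarrow> \<bar>f x\<bar> \<le> B"
  shows "\<bar>frac_integral a f t - frac_integral a f s\<bar> \<le> 2 * B * (t - s) powr a / Gamma (1 + a)"
proof -
  have B0: "0 \<le> B" using B[of s] st by auto
  have f': "continuous_on {0..s} f" "continuous_on {s..t} f"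
    using f st by (auto elim: continuous_on_subset)
  define K where "K = (\<lambda>\<tau> x. (\<tau> - x) powr (a - 1))"
  have Kt: "((\<lambda>x. K t x) has_integral (t powr a - (t - s) powr a) / a) {0..s}"
  proof -
    have i: "(K t) integrable_on {0..t}"
      using has_integral_powr_diff[of a 0 t] a st unfolding K_def by (auto simp: integrable_on_def)
    have "integral {0..s} (K t) + integral {s..t} (K t) = integral {0..t} (K t)"
      using st i by (intro Henstock_Kurzweil_Integration.integral_combine) auto
    moreover have "integral {s..t} (K t) = (t - s) powr a / a" "integral {0..t} (K t) = t powr a / a"
      using has_integral_powr_diff[of a s t] has_integral_powr_diff[of a 0 t] a st
      unfolding K_def by (auto intro!: integral_unique)
    moreover have "K t integrable_on {0..s}"
      using i st by (rule_tac integrable_on_subinterval[OF i]) auto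
    ultimately have "K t integrable_on {0..s}" "integral {0..s} (K t) = (t powr a - (t - s) powr a) / a"
      by (auto simp: diff_divide_distrib)
    then show ?thesis by (metis has_integral_iff)
  qed
  have Ks: "(K s has_integral s powr a / a) {0..s}"
    using has_integral_powr_diff[of a 0 s] a st by (simp add: K_def)
  have Ktf: "(\<lambda>x. K t x * f x) integrable_on {0..t}"
    using a f unfolding K_def by (intro kernel_mult_integrable)
  then have Ktf': "(\<lambda>x. K t x * f x) integrable_on {0..s}"
    using st by (rule_tac integrable_on_subinterval[OF Ktf]) auto
  have Ksf: "(\<lambda>x. K s x * f x) integrable_on {0..s}"
    using a f' unfolding K_def by (intro kernel_mult_integrable)
  have split: "integral {0..t} (\<lambda>x. K t x * f x) - integral {0..s} (\<lambda>x. K s x * f x)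
     = integral {0..s} (\<lambda>x. K t x * f x - K s x * f x) + integral {s..t} (\<lambda>x. K t x * f x)"
    using Henstock_Kurzweil_Integration.integral_combine[of 0 s t "\<lambda>x. K t x * f x"] st Ktf Ktf' Ksf
    by (simp add: integral_diff)
  have 1: "\<bar>integral {s..t} (\<lambda>x. K t x * f x)\<bar> \<le> B * (t - s) powr a / a"
    unfolding K_def using a st f' B by (intro abs_integral_kernel_le) auto
  \<comment> \<open>At x = s the value \<open>0 powr (a - 1)\<close> is 0, which can break
    \<open>K t x \<le> K s x\<close>; passing to the open interval removes this point.\<close>
  have g: "((\<lambda>x. B * (K s x - K t x)) has_integral
      B * (s powr a / a - (t powr a - (t - s) powr a) / a)) {0<..<s}"
    using has_integral_mult_right[OF has_integral_diff[OF Ks Kt], of B]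
    by (simp add: has_integral_open_interval flip: box_real)
  have "norm (integral {0<..<s} (\<lambda>x. K t x * f x - K s x * f x))
      \<le> integral {0<..<s} (\<lambda>x. B * (K s x - K t x))"
  proof (intro integral_norm_bound_integral)
    show "(\<lambda>x. K t x * f x - K s x * f x) integrable_on {0<..<s}"
      using integrable_diff[OF Ktf' Ksf] by (simp add: integrable_on_open_interval flip: box_real)
    show "(\<lambda>x. B * (K s x - K t x)) integrable_on {0<..<s}"
      using g by auto
    fix x assume x: "x \<in> {0<..<s}"
    have "K t x \<le> K s x" unfolding K_def using x st a by (intro powr_mono2') auto
    then have "\<bar>f x\<bar> * \<bar>K t x - K s x\<bar> \<le> B * (K s x - K t x)"
      using B[of x] x st B0 by (intro mult_mono) auto
    then show "norm (K t x * f x - K s x * f x) \<le> B * (K s x - K t x)"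
      by (simp add: abs_mult[symmetric] algebra_simps)
  qed
  also have "\<dots> = B * (s powr a / a - (t powr a - (t - s) powr a) / a)"
    using g by (rule integral_unique)
  also have "\<dots> \<le> B * ((t - s) powr a / a)"
    using a st B0 by (intro mult_left_mono) (auto simp: field_simps intro!: powr_mono2)
  finally have 2: "\<bar>integral {0..s} (\<lambda>x. K t x * f x - K s x * f x)\<bar> \<le> B * (t - s) powr a / a"
    by (simp add: integral_open_interval_real)
  have G: "a * Gamma a = Gamma (1 + a)" "0 < Gamma a"
    using a Gamma_plus1[of a] by (auto simp: add.commute nonpos_Ints_def)
  have "\<bar>frac_integral a f t - frac_integral a f s\<bar> =
     \<bar>integral {0..t} (\<lambda>x. K t x * f x) - integral {0..s} (\<lambda>x. K s x * f x)\<bar> / Gamma a"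
    using G by (simp add: frac_integral_def K_def diff_divide_distrib[symmetric])
  also have "\<dots> \<le> (2 * (B * (t - s) powr a / a)) / Gamma a"
    unfolding split using 1 2 G by (intro divide_right_mono) linarith+
  also have "\<dots> = 2 * B * (t - s) powr a / Gamma (1 + a)"
    by (simp add: G(1)[symmetric])
  finally show ?thesis .
qed

lemma continuous_on_bounded_abs:
  fixes f :: "real \<Rightarrow> real"
  assumes "continuous_on {a..b} f"
  obtains B where "0 \<le> B" "\<And>x. x \<in> {a..b} \<Longrightarrow> \<bar>f x\<bar> \<le> B"
proof -
  have "bounded (f ` {a..b})"
    using assms by (intro compact_imp_bounded compact_continuous_image) auto
  then obtain B where "0 < B" "\<forall>y \<in> f ` {a..b}. norm y \<le> B"
    unfolding bounded_pos by blast
  then show ?thesis by (intro that[of B]) auto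
qed

text \<open>Serves twice: it gives the continuity of fractional integrals, and it supplies Hoelder
  exponents for coefficients that are themselves fractional integrals up to a constant.\<close>

lemma holder_on_frac_integral:
  assumes a: "0 < a" "a \<le> 1" and f: "continuous_on {0..b} f"
  shows "holder_on b a (frac_integral a f)"
proof -
  obtain B where B: "\<And>x. x \<in> {0..b} \<Longrightarrow> \<bar>f x\<bar> \<le> B" by (rule continuous_on_bounded_abs[OF f]) blast
  have *: "\<bar>frac_integral a f t - frac_integral a f s\<bar> \<le> 2 * B / Gamma (1 + a) * \<bar>t - s\<bar> powr a"
    if "0 \<le> s" "s \<le> t" "t \<le> b" for s t
    using frac_integral_holder[of a s t f B] continuous_on_subset[OF f, of "{0..t}"] that a B by auto
  show ?thesis unfolding holder_on_def
  proof (intro exI ballI)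
    fix s t assume "s \<in> {0..b}" "t \<in> {0..b}"
    then show "\<bar>frac_integral a f t - frac_integral a f s\<bar> \<le> 2 * B / Gamma (1 + a) * \<bar>t - s\<bar> powr a"
      using *[of s t] *[of t s] by (cases "s \<le> t") (auto simp: abs_minus_commute)
  qed
qed

lemma holder_on_imp_continuous_on:
  assumes "0 < a" "holder_on b a f"
  shows "continuous_on {0..b} f"
proof -
  obtain L where L: "\<And>s t. s \<in> {0..b} \<Longrightarrow> t \<in> {0..b} \<Longrightarrow> \<bar>f t - f s\<bar> \<le> L * \<bar>t - s\<bar> powr a"
    using assms(2) unfolding holder_on_def by blast
  show ?thesis unfolding continuous_on_def
  proof
    fix s assume s: "s \<in> {0..b}"
    have "((\<lambda>t. L * \<bar>t - s\<bar> powr a) \<longlongrightarrow> L * \<bar>s - s\<bar> powr a) (at s within {0..b})"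
      using assms(1) by (intro tendsto_intros tendsto_powr') auto
    then have "((\<lambda>t. L * \<bar>t - s\<bar> powr a) \<longlongrightarrow> 0) (at s within {0..b})" using assms by simp
    then have "((\<lambda>t. f t - f s) \<longlongrightarrow> 0) (at s within {0..b})"
      by (rule Lim_null_comparison[rotated])
         (use L s in \<open>auto simp: eventually_at_filter\<close>)
    then show "(f \<longlongrightarrow> f s) (at s within {0..b})" by (simp add: LIM_zero_iff)
  qed
qed

lemmas continuous_on_frac_integral =
  holder_on_imp_continuous_on[OF _ holder_on_frac_integral]

section \<open>The semigroup law\<close>

text \<open>The substitution y = (x - s) / (t - s) reduces this to the Beta integral on [0, 1]. It
  evaluates the inner integral in the semigroup law.\<close>

lemma has_integral_Beta_interval:
  fixes a b s t :: real
  assumes "0 < a" "0 < b" "s < t"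
  shows "((\<lambda>x. (t - x) powr (a - 1) * (x - s) powr (b - 1)) has_integral
           Beta a b * (t - s) powr (a + b - 1)) {s..t}"
proof -
  have "((\<lambda>y. y powr (b - 1) * (1 - y) powr (a - 1)) has_integral Beta b a) {0..1}"
    using assms by (intro has_integral_Beta_real) auto
  then have "((\<lambda>x. (\<lambda>y. y powr (b - 1) * (1 - y) powr (a - 1)) ((1 / (t - s)) *\<^sub>R x + - s / (t - s)))
      has_integral (Beta b a /\<^sub>R (1 / (t - s)) ^ DIM(real)))
      (cbox ((0 - - s / (t - s)) /\<^sub>R (1 / (t - s))) ((1 - - s / (t - s)) /\<^sub>R (1 / (t - s))))"
    unfolding cbox_interval[symmetric] using assms by (intro has_integral_affinity') auto
  also have "cbox ((0 - - s / (t - s)) /\<^sub>R (1 / (t - s))) ((1 - - s / (t - s)) /\<^sub>R (1 / (t - s))) = {s..t}"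
    using assms by (simp add: field_simps)
  also have "(\<lambda>x. (1 / (t - s)) *\<^sub>R x + - s / (t - s)) = (\<lambda>x. (x - s) / (t - s))"
    by (simp add: diff_divide_distrib)
  also have "(\<lambda>x. 1 - (x - s) / (t - s)) = (\<lambda>x. (t - x) / (t - s))"
    using assms by (simp add: field_simps)
  \<comment> \<open>The factor \<open>(t - s) powr (a + b - 2)\<close> undoes the scaling of the two
    powers; the remaining t - s on the right is the Jacobian.\<close>
  finally have "((\<lambda>x. (t - s) powr (a + b - 2) * (((x - s) / (t - s)) powr (b - 1) * ((t - x) / (t - s)) powr (a - 1)))
      has_integral (t - s) powr (a + b - 2) * (Beta b a * (t - s))) {s..t}"
    by (intro has_integral_mult_right) (simp add: mult.commute)
  moreover have "(t - s) powr (a + b - 2) * (Beta b a * (t - s)) = Beta a b * (t - s) powr (a + b - 1)"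
  proof -
    have "(t - s) powr (a + b - 1) = (t - s) powr (a + b - 2) * (t - s)"
      using assms powr_add[of "t - s" "a + b - 2" 1] by simp
    then show ?thesis by (simp add: Beta_commute[of a b])
  qed
  moreover have "(t - s) powr (a + b - 2) * (((x - s) / (t - s)) powr (b - 1) * ((t - x) / (t - s)) powr (a - 1))
     = (t - x) powr (a - 1) * (x - s) powr (b - 1)" if "x \<in> {s..t}" for x
  proof -
    have "(t - s) powr (a + b - 2) = (t - s) powr (b - 1) * (t - s) powr (a - 1)"
      by (simp add: powr_add[symmetric] algebra_simps)
    then show ?thesis using assms that by (simp add: powr_divide)
  qed
  ultimately show ?thesis by (metis (mono_tags, lifting) has_integral_eq)
qed

text \<open>Passage from integrals over sets to \<open>lborel\<close>, where Fubini's theorem is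
  applied. Borel measurability is what carries integrability from the completed measure back to
  \<open>lborel\<close>.\<close>

lemma borel_absolutely_integrable_lborel:
  fixes f :: "real \<Rightarrow> real"
  assumes "f absolutely_integrable_on S" "S \<in> sets borel" "f \<in> borel_measurable borel"
  shows "has_bochner_integral lborel (\<lambda>x. indicator S x * f x) (integral S f)"
proof -
  have "integrable lebesgue (\<lambda>x. indicator S x *\<^sub>R f x)"
    using assms(1) by (simp add: set_integrable_def)
  moreover have "(\<lambda>x. indicator S x *\<^sub>R f x) \<in> borel_measurable lborel"
    using assms by measurable
  ultimately have i: "integrable lborel (\<lambda>x. indicator S x *\<^sub>R f x)"
    by (simp only: integrable_completion)
  then have "set_integrable lborel S f" by (simp add: set_integrable_def)
  from set_borel_integral_eq_integral(2)[OF this] i show ?thesis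
    by (simp add: has_bochner_integral_iff set_lebesgue_integral_def)
qed

text \<open>Exchange the integrals over the triangle 0 \<le> s \<le> x \<le> t: the inner integral
  in x is \<open>Beta a b\<close> times (t - s)^(a + b - 1), and the Gamma factors cancel. The bound
  \<open>b \<le> 1\<close> enters through the continuity of the inner fractional integral, taken
  from its Hoelder estimate.\<close>

theorem frac_integral_add:
  assumes a: "0 < a" and b: "0 < b" "b \<le> 1" and t: "0 \<le> t" and f: "continuous_on {0..t} f"
  shows "frac_integral a (frac_integral b f) t = frac_integral (a + b) f t"
proof -
  \<comment> \<open>The first two indicators encode the triangle. The one multiplying
    \<open>g s\<close> makes that factor Borel on the whole line, since g is only continuous on
    [0, t]. The function g is a parameter because both f and its absolute value will be
    inserted.\<close>
  define F where "F g = (\<lambda>(x, s). indicator {0..x} s * (indicator {0..t} x *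
     ((t - x) powr (a - 1) * ((x - s) powr (b - 1) * (indicator {0..t} s * g s)))))" for g :: "real \<Rightarrow> real"
  have meas_g: "(\<lambda>s. indicator {0..t} s * g s) \<in> borel_measurable borel"
    if "continuous_on {0..t} g" for g :: "real \<Rightarrow> real"
    using borel_measurable_continuous_on_indicator[OF _ that] by simp
  have meas: "F g \<in> borel_measurable (lborel \<Otimes>\<^sub>M lborel)" if "continuous_on {0..t} g" for g
  proof -
    have [measurable]: "(\<lambda>s. indicator {0..t} s * g s) \<in> borel_measurable borel"
      using meas_g[OF that] .
    have [measurable]: "(\<lambda>p :: real \<times> real. indicator {0..fst p} (snd p) :: real) \<in> borel_measurable (lborel \<Otimes>\<^sub>M lborel)"
    proof -
      have "closed {p :: real \<times> real. 0 \<le> snd p \<and> snd p \<le> fst p}"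
        by (intro closed_Collect_conj closed_Collect_le continuous_intros)
      then have "indicat_real {p :: real \<times> real. 0 \<le> snd p \<and> snd p \<le> fst p} \<in> borel_measurable (lborel \<Otimes>\<^sub>M lborel)"
        unfolding lborel_prod by (simp add: borel_measurable_indicator)
      moreover have "(\<lambda>p. indicator {0..fst p} (snd p)) = indicat_real {p :: real \<times> real. 0 \<le> snd p \<and> snd p \<le> fst p}"
        by (auto simp: indicator_def fun_eq_iff)
      ultimately show ?thesis by (simp only:)
    qed
    show ?thesis unfolding F_def split_beta by measurable
  qed
  have inner1: "has_bochner_integral lborel (\<lambda>s. F g (x, s))
      (indicator {0..t} x * ((t - x) powr (a - 1) * (Gamma b * frac_integral b g x)))"
    if g: "continuous_on {0..t} g" for g x
  proof (cases "x \<in> {0..t}")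
    case True
    have g': "continuous_on {0..x} g" using g True by (auto elim: continuous_on_subset)
    have eq: "(x - s) powr (b - 1) * (indicator {0..t} s * g s) = (x - s) powr (b - 1) * g s"
      if "s \<in> {0..x}" for s
      using that True by auto
    have "(\<lambda>s. (x - s) powr (b - 1) * (indicator {0..t} s * g s)) absolutely_integrable_on {0..x}"
      by (rule set_integrable_cong[THEN iffD2, OF refl refl eq absolutely_integrable_kernel_mult[OF b(1) g']])
    moreover have "(\<lambda>s. (x - s) powr (b - 1) * (indicator {0..t} s * g s)) \<in> borel_measurable borel"
      using meas_g[OF g] by measurable
    ultimately have "has_bochner_integral lborel
       (\<lambda>s. indicator {0..x} s * ((x - s) powr (b - 1) * (indicator {0..t} s * g s)))
       (integral {0..x} (\<lambda>s. (x - s) powr (b - 1) * (indicator {0..t} s * g s)))"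
      by (intro borel_absolutely_integrable_lborel) auto
    also have "integral {0..x} (\<lambda>s. (x - s) powr (b - 1) * (indicator {0..t} s * g s)) = 
       Gamma b * frac_integral b g x"
      using Gamma_real_pos[OF b(1)] integral_cong[where s = "{0..x}", OF eq] by (simp add: frac_integral_def)
    finally have "has_bochner_integral lborel
       (\<lambda>s. (t - x) powr (a - 1) * (indicator {0..x} s * ((x - s) powr (b - 1) * (indicator {0..t} s * g s))))
       ((t - x) powr (a - 1) * (Gamma b * frac_integral b g x))"
      by (rule has_bochner_integral_mult_right)
    then show ?thesis
      using True by (simp add: F_def mult_ac)
  qed (auto simp: F_def has_bochner_integral_zero)
  \<comment> \<open>The Beta integral requires s < t; the point s = t is discarded below as a null
    set.\<close>
  have inner2: "(LBINT x. F f (x, s)) =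
      indicator {0..t} s * f s * (Beta a b * (t - s) powr (a + b - 1))" if "s \<noteq> t" for s
  proof (cases "s \<in> {0..<t}")
    case True
    then have *: "((\<lambda>x. (t - x) powr (a - 1) * (x - s) powr (b - 1)) has_integral
           Beta a b * (t - s) powr (a + b - 1)) {s..t}"
      using a b by (intro has_integral_Beta_interval) auto
    then have "(\<lambda>x. (t - x) powr (a - 1) * (x - s) powr (b - 1)) absolutely_integrable_on {s..t}"
      by (intro nonnegative_absolutely_integrable_1) auto
    then have "has_bochner_integral lborel (\<lambda>x. indicator {s..t} x * ((t - x) powr (a - 1) * (x - s) powr (b - 1)))
        (Beta a b * (t - s) powr (a + b - 1))"
      using borel_absolutely_integrable_lborel[where S = "{s..t}"
          and f = "\<lambda>x. (t - x) powr (a - 1) * (x - s) powr (b - 1)"]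
      by (simp add: integral_unique[OF *])
    then have "has_bochner_integral lborel (\<lambda>x. f s * (indicator {s..t} x * ((t - x) powr (a - 1) * (x - s) powr (b - 1))))
        (f s * (Beta a b * (t - s) powr (a + b - 1)))"
      by (intro has_bochner_integral_mult_right) auto
    also have "(\<lambda>x. f s * (indicator {s..t} x * ((t - x) powr (a - 1) * (x - s) powr (b - 1)))) = 
       (\<lambda>x. F f (x, s))"
      using True by (auto simp: F_def indicator_def)
    finally show ?thesis using True by (simp add: has_bochner_integral_integral_eq)
  next
    case False
    then have "F f (x, s) = 0" for x using that by (auto simp: F_def indicator_def)
    moreover have "indicator {0..t} s = (0::real)" using False that by auto
    ultimately show ?thesis by simp
  qed
  have cont_frac: "continuous_on {0..t} (frac_integral b g)" if "continuous_on {0..t} g" for g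
    using continuous_on_frac_integral b that by auto
  have kernel_ind: "(\<lambda>s. (t - s) powr (c - 1) * (indicator {0..t} s * g s)) absolutely_integrable_on {0..t}"
    if "0 < c" "continuous_on {0..t} g" for c g
    by (rule set_integrable_cong[THEN iffD2, OF refl refl _ absolutely_integrable_kernel_mult[OF that]]) auto
  have outer1: "has_bochner_integral lborel
      (\<lambda>x. indicator {0..t} x * ((t - x) powr (a - 1) * (Gamma b * frac_integral b g x)))
      (Gamma b * Gamma a * frac_integral a (frac_integral b g) t)"
    if g: "continuous_on {0..t} g" for g
  proof -
    let ?h = "\<lambda>x. indicator {0..t} x * (Gamma b * frac_integral b g x)"
    have [measurable]: "?h \<in> borel_measurable borel"
      by (intro meas_g continuous_intros cont_frac g)
    have "(\<lambda>x. (t - x) powr (a - 1) * ?h x) \<in> borel_measurable borel"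
      by measurable
    moreover have "(\<lambda>x. (t - x) powr (a - 1) * ?h x) absolutely_integrable_on {0..t}"
      by (intro kernel_ind a continuous_intros cont_frac g)
    ultimately have "has_bochner_integral lborel (\<lambda>x. indicator {0..t} x * ((t - x) powr (a - 1) * ?h x))
       (integral {0..t} (\<lambda>x. (t - x) powr (a - 1) * ?h x))"
      by (intro borel_absolutely_integrable_lborel) auto
    also have "integral {0..t} (\<lambda>x. (t - x) powr (a - 1) * ?h x) =
        integral {0..t} (\<lambda>x. Gamma b * ((t - x) powr (a - 1) * frac_integral b g x))"
      by (intro integral_cong) auto
    also have "\<dots> = Gamma b * Gamma a * frac_integral a (frac_integral b g) t"
      using Gamma_real_pos[OF a] by (simp add: frac_integral_def)
    also have "(\<lambda>x. indicator {0..t} x * ((t - x) powr (a - 1) * ?h x)) =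
       (\<lambda>x. indicator {0..t} x * ((t - x) powr (a - 1) * (Gamma b * frac_integral b g x)))"
      by (auto simp: indicator_def)
    finally show ?thesis .
  qed
  \<comment> \<open>The kernels are nonnegative, so the absolute value of \<open>F f\<close> is F of
    the absolute value of f. The iterated integrals already computed then yield the absolute
    integrability that Fubini requires.\<close>
  have fabs: "continuous_on {0..t} (\<lambda>s. \<bar>f s\<bar>)" using f by (intro continuous_intros)
  have nF: "norm (F f p) = F (\<lambda>s. \<bar>f s\<bar>) p" for p
    by (cases p) (auto simp: F_def abs_mult indicator_def)
  have "integrable (lborel \<Otimes>\<^sub>M lborel) (F f)"
  proof (rule lborel_pair.Fubini_integrable)
    show "F f \<in> borel_measurable (lborel \<Otimes>\<^sub>M lborel)" by (rule meas[OF f])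
    show "integrable lborel (\<lambda>x. LBINT y. norm (F f (x, y)))"
      unfolding nF has_bochner_integral_integral_eq[OF inner1[OF fabs]]
      using outer1[OF fabs] by (simp add: has_bochner_integral_iff)
    show "AE x in lborel. integrable lborel (\<lambda>y. F f (x, y))"
      using inner1[OF f] by (simp add: has_bochner_integral_iff)
  qed
  then have "(LBINT s. LBINT x. F f (x, s)) = (LBINT x. LBINT s. F f (x, s))"
    by (intro lborel_pair.Fubini_integral) (simp add: split_beta')
  also have "\<dots> = Gamma b * Gamma a * frac_integral a (frac_integral b f) t"
    unfolding has_bochner_integral_integral_eq[OF inner1[OF f]]
    using outer1[OF f] by (simp add: has_bochner_integral_iff)
  also have "(LBINT s. LBINT x. F f (x, s)) =
      (LBINT s. indicator {0..t} s * f s * (Beta a b * (t - s) powr (a + b - 1)))"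
  proof (rule integral_cong_AE)
    show "(\<lambda>s. LBINT x. F f (x, s)) \<in> borel_measurable lborel"
      using meas[OF f] by measurable
    show "(\<lambda>s. indicator {0..t} s * f s * (Beta a b * (t - s) powr (a + b - 1))) \<in> borel_measurable lborel"
      using meas_g[OF f] by measurable
    show "AE s in lborel. (LBINT x. F f (x, s)) = indicator {0..t} s * f s * (Beta a b * (t - s) powr (a + b - 1))"
      using AE_lborel_singleton[of t] by eventually_elim (rule inner2)
  qed
  also have "\<dots> = Beta a b * Gamma (a + b) * frac_integral (a + b) f t"
  proof -
    let ?h = "\<lambda>s. (t - s) powr (a + b - 1) * (indicator {0..t} s * f s)"
    have "?h absolutely_integrable_on {0..t}"
      using a b f by (intro kernel_ind) auto
    moreover have "?h \<in> borel_measurable borel" using meas_g[OF f] by measurable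
    ultimately have "has_bochner_integral lborel (\<lambda>s. indicator {0..t} s * ?h s) (integral {0..t} ?h)"
      by (intro borel_absolutely_integrable_lborel) auto
    also have "integral {0..t} ?h = integral {0..t} (\<lambda>s. (t - s) powr (a + b - 1) * f s)"
      by (intro integral_cong) auto
    also have "\<dots> = Gamma (a + b) * frac_integral (a + b) f t"
      using Gamma_real_pos[OF add_pos_pos[OF a b(1)]] by (simp add: frac_integral_def)
    finally have "has_bochner_integral lborel (\<lambda>s. Beta a b * (indicator {0..t} s * ?h s))
       (Beta a b * (Gamma (a + b) * frac_integral (a + b) f t))"
      by (rule has_bochner_integral_mult_right)
    also have "(\<lambda>s. Beta a b * (indicator {0..t} s * ?h s)) = 
      (\<lambda>s. indicator {0..t} s * f s * (Beta a b * (t - s) powr (a + b - 1)))"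
      by (auto simp: indicator_def)
    finally show ?thesis by (simp add: has_bochner_integral_integral_eq mult.assoc)
  qed
  finally show ?thesis
    using Gamma_real_pos[OF a] Gamma_real_pos[OF b(1)] Gamma_real_pos[OF add_pos_pos[OF a b(1)]]
    by (simp add: Beta_def)
qed


subsection \<open>Caputo derivatives as inverses of fractional integrals\<close>

lemma caputo_integral_eq_frac_integral:
  assumes "\<theta> < 1"
  shows "caputo_integral \<theta> w t = Gamma (1 - \<theta>) * frac_integral (1 - \<theta>) (\<lambda>s. w s - w 0) t"
proof -
  have "Gamma (1 - \<theta>) > 0" using assms by (intro Gamma_real_pos) auto
  \<comment> \<open>The integrands agree even at s = t, where division by 0 and
    \<open>0 powr -\<theta>\<close> both give 0.\<close>
  then show ?thesis
    by (simp add: caputo_integral_def frac_integral_def powr_minus divide_inverse mult.commute)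
qed

text \<open>The defining equation in integrated form; differentiating the right-hand side recovers
  \<phi>. The value at 0 is included because \<open>caputo\<close> is there the right limit of
  \<phi>, which is continuous.\<close>

lemma caputo_eqI:
  assumes b: "0 < b" and \<theta>: "\<theta> < 1" and \<phi>: "continuous_on {0..b} \<phi>"
    and eq: "\<And>t. t \<in> {0..b} \<Longrightarrow> frac_integral (1 - \<theta>) (\<lambda>s. w s - w 0) t = integral {0..t} \<phi>"
  shows "caputo_continuous b \<theta> w" and "\<And>t. t \<in> {0..b} \<Longrightarrow> caputo b \<theta> w t = \<phi> t"
proof -
  have G: "Gamma (1 - \<theta>) > 0" using \<theta> by (intro Gamma_real_pos) auto
  have deriv: "(caputo_integral \<theta> w has_vector_derivative Gamma (1 - \<theta>) * \<phi> t) (at t within {0..b})"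
    if t: "t \<in> {0..b}" for t
  proof (rule has_vector_derivative_transform[OF t])
    show "((\<lambda>t. Gamma (1 - \<theta>) * integral {0..t} \<phi>) has_vector_derivative Gamma (1 - \<theta>) * \<phi> t)
        (at t within {0..b})"
      by (intro has_vector_derivative_mult_right integral_has_vector_derivative \<phi> t)
  qed (simp add: eq caputo_integral_eq_frac_integral[OF \<theta>])
  have pos: "caputo_pos b \<theta> w t = \<phi> t" if "t \<in> {0..b}" for t
    using vector_derivative_within_cbox[unfolded cbox_interval, OF b, of t, OF _ deriv[OF that]] that G
    by (simp add: caputo_pos_def)
  have "(\<phi> \<longlongrightarrow> \<phi> 0) (at_right 0)"
    using \<phi> b by (rule continuous_on_Icc_at_rightD)
  moreover have "\<forall>\<^sub>F t in at_right 0. \<phi> t = caputo_pos b \<theta> w t"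
    using b pos by (intro eventually_at_rightI[of 0 b]) auto
  ultimately have "(caputo_pos b \<theta> w \<longlongrightarrow> \<phi> 0) (at_right 0)"
    by (rule Lim_transform_eventually)
  then have lim: "Lim (at_right 0) (caputo_pos b \<theta> w) = \<phi> 0"
    by (intro tendsto_Lim) auto
  show val: "caputo b \<theta> w t = \<phi> t" if "t \<in> {0..b}" for t
    using pos[OF that] lim by (simp add: caputo_def)
  show "caputo_continuous b \<theta> w"
    unfolding caputo_continuous_def
  proof
    show "\<forall>t\<in>{0<..b}. caputo_integral \<theta> w differentiable at t within {0..b}"
      by (intro ballI differentiableI_vector[OF deriv]) auto
    show "continuous_on {0..b} (caputo b \<theta> w)"
      using \<phi> val by (metis continuous_on_cong)
  qed
qed

text \<open>Converse of \<open>caputo_eqI\<close>. The definition provides no derivative at 0, so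
  the fundamental theorem is used in the form that needs derivatives only in the interior and
  continuity up to the endpoints.\<close>

lemma frac_integral_caputo_continuous:
  assumes b: "0 < b" and \<theta>: "0 < \<theta>" "\<theta> < 1" and w: "continuous_on {0..b} w"
    and cc: "caputo_continuous b \<theta> w" and t: "t \<in> {0..b}"
  shows "frac_integral (1 - \<theta>) (\<lambda>s. w s - w 0) t = integral {0..t} (caputo b \<theta> w)"
proof -
  have G: "Gamma (1 - \<theta>) > 0" using \<theta> by (intro Gamma_real_pos) auto
  let ?c = "caputo_integral \<theta> w"
  have "((\<lambda>x. Gamma (1 - \<theta>) * caputo b \<theta> w x) has_integral (?c t - ?c 0)) {0..t}"
  proof (rule fundamental_theorem_of_calculus_interior)
    show "0 \<le> t" using t by simp
    have "continuous_on {0..b} (frac_integral (1 - \<theta>) (\<lambda>s. w s - w 0))"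
      using \<theta> by (intro continuous_on_frac_integral continuous_intros w) auto
    then show "continuous_on {0..t} ?c"
      unfolding caputo_integral_eq_frac_integral[OF \<theta>(2), abs_def] using t
      by (intro continuous_intros) (auto elim: continuous_on_subset)
    fix x assume x: "x \<in> {0<..<t}"
    then have "?c differentiable at x within {0..b}"
      using cc t by (auto simp: caputo_continuous_def)
    then have "(?c has_vector_derivative vector_derivative ?c (at x within {0..b})) (at x within {0..b})"
      by (simp add: vector_derivative_works)
    moreover have "at x within {0..b} = at x"
      using x t by (intro at_within_Icc_at) auto
    ultimately show "(?c has_vector_derivative Gamma (1 - \<theta>) * caputo b \<theta> w x) (at x)"
      using G x by (simp add: caputo_def caputo_pos_def)
  qed
  then have "((\<lambda>x. Gamma (1 - \<theta>) * caputo b \<theta> w x) has_integral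
      (Gamma (1 - \<theta>) * frac_integral (1 - \<theta>) (\<lambda>s. w s - w 0) t)) {0..t}"
    by (simp add: caputo_integral_eq_frac_integral[OF \<theta>(2)])
  from integral_unique[OF this] G show ?thesis by simp
qed

section \<open>Inversion of Abel's integral equation\<close>

text \<open>Injectivity of the Abel operator: applying the integral of order 1 - a leaves the
  ordinary integral of h equal to 0 on every [0, t], and differentiation gives h = 0.\<close>

lemma frac_integral_eq_0_imp:
  assumes b: "0 < b" and a: "0 < a" "a < 1" and h: "continuous_on {0..b} h"
    and eq: "\<And>t. t \<in> {0..b} \<Longrightarrow> frac_integral a h t = 0" and t: "t \<in> {0..b}"
  shows "h t = 0"
proof -
  have zero: "integral {0..t} h = 0" if t: "t \<in> {0..b}" for t
  proof -
    have "frac_integral (1 - a) (frac_integral a h) t = frac_integral (1 - a) (\<lambda>_. 0) t"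
      using eq t by (intro frac_integral_cong) auto
    then show ?thesis
      using frac_integral_add[of "1 - a" a t h] a t continuous_on_subset[OF h, of "{0..t}"]
      by (simp add: frac_integral_1 frac_integral_const)
  qed
  have 1: "((\<lambda>u. integral {0..u} h) has_vector_derivative h t) (at t within {0..b})"
    by (intro integral_has_vector_derivative h t)
  have 2: "((\<lambda>u. integral {0..u} h) has_vector_derivative 0) (at t within {0..b})"
    using t zero by (intro has_vector_derivative_transform[OF t _ has_vector_derivative_const[of 0]]) auto
  show ?thesis
    using vector_derivative_within_cbox[unfolded cbox_interval, OF b _ 1] vector_derivative_within_cbox[unfolded cbox_interval, OF b _ 2] t by simp
qed

text \<open>Both sides have the same fractional integral of order 1 - \<theta>, namely the ordinary
  integral of the Caputo derivative: the left by the preceding converse, the right by the semigroup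
  law. Injectivity finishes.\<close>

lemma caputo_imp_frac_integral:
  assumes b: "0 < b" and \<theta>: "0 < \<theta>" "\<theta> < 1" and w: "continuous_on {0..b} w"
    and cc: "caputo_continuous b \<theta> w" and t: "t \<in> {0..b}"
  shows "w t - w 0 = frac_integral \<theta> (caputo b \<theta> w) t"
proof -
  let ?D = "caputo b \<theta> w"
  have D: "continuous_on {0..b} ?D" using cc by (simp add: caputo_continuous_def)
  have I: "continuous_on {0..b} (frac_integral \<theta> ?D)"
    using \<theta> D by (intro continuous_on_frac_integral) auto
  have "w t - w 0 - frac_integral \<theta> ?D t = 0"
  proof (rule frac_integral_eq_0_imp[OF b, where a = "1 - \<theta>"
        and h = "\<lambda>t. w t - w 0 - frac_integral \<theta> ?D t"])
    show "continuous_on {0..b} (\<lambda>t. w t - w 0 - frac_integral \<theta> ?D t)"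
      by (intro continuous_intros w I)
    fix t assume t: "t \<in> {0..b}"
    then have sub: "{0..t} \<subseteq> {0..b}" by auto
    have "frac_integral (1 - \<theta>) (\<lambda>s. (w s - w 0) - frac_integral \<theta> ?D s) t =
       frac_integral (1 - \<theta>) (\<lambda>s. w s - w 0) t - frac_integral (1 - \<theta>) (frac_integral \<theta> ?D) t"
      using \<theta> by (intro frac_integral_diff continuous_intros continuous_on_subset[OF w sub]
          continuous_on_subset[OF I sub]) auto
    also have "frac_integral (1 - \<theta>) (frac_integral \<theta> ?D) t = integral {0..t} ?D"
      using \<theta> t frac_integral_add[of "1 - \<theta>" \<theta> t ?D] continuous_on_subset[OF D sub]
      by (simp add: frac_integral_1)
    also have "frac_integral (1 - \<theta>) (\<lambda>s. w s - w 0) t = integral {0..t} ?D"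
      by (rule frac_integral_caputo_continuous[OF b \<theta> w cc t])
    finally show "frac_integral (1 - \<theta>) (\<lambda>s. (w s - w 0) - frac_integral \<theta> ?D s) t = 0" by simp
  qed (use \<theta> t in auto)
  then show ?thesis by simp
qed

text \<open>By the semigroup law, orders 1 - \<theta> and \<mu> combine to 1 + (\<mu> - \<theta>),
  which splits again as an ordinary integral of the order \<mu> - \<theta>. Since this order is
  positive, the derivative vanishes at 0.\<close>

lemma caputo_frac_integral:
  assumes b: "0 < b" and \<theta>: "0 < \<theta>" "\<theta> < \<mu>" "\<mu> \<le> 1" and \<psi>: "continuous_on {0..b} \<psi>"
    and eq: "\<And>t. t \<in> {0..b} \<Longrightarrow> w t - w 0 = frac_integral \<mu> \<psi> t"
  shows "caputo_continuous b \<theta> w" and "\<And>t. t \<in> {0..b} \<Longrightarrow> caputo b \<theta> w t = frac_integral (\<mu> - \<theta>) \<psi> t"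
proof -
  have cont: "continuous_on {0..b} (frac_integral (\<mu> - \<theta>) \<psi>)"
    using \<theta> \<psi> by (intro continuous_on_frac_integral) auto
  have "frac_integral (1 - \<theta>) (\<lambda>s. w s - w 0) t = integral {0..t} (frac_integral (\<mu> - \<theta>) \<psi>)"
    if t: "t \<in> {0..b}" for t
  proof -
    have \<psi>t: "continuous_on {0..t} \<psi>" using \<psi> t by (auto elim: continuous_on_subset)
    have "frac_integral (1 - \<theta>) (\<lambda>s. w s - w 0) t = frac_integral (1 - \<theta>) (frac_integral \<mu> \<psi>) t"
      using t eq by (intro frac_integral_cong) auto
    also have "\<dots> = frac_integral (1 - \<theta> + \<mu>) \<psi> t"
      using \<theta> t \<psi>t by (intro frac_integral_add) auto
    also have "\<dots> = frac_integral (1 + (\<mu> - \<theta>)) \<psi> t"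
      by (simp add: algebra_simps)
    also have "\<dots> = frac_integral 1 (frac_integral (\<mu> - \<theta>) \<psi>) t"
      using \<theta> t \<psi>t by (intro frac_integral_add[symmetric]) auto
    finally show ?thesis by (simp add: frac_integral_1)
  qed
  from caputo_eqI[OF b _ cont this] \<theta>
  show "caputo_continuous b \<theta> w" "\<And>t. t \<in> {0..b} \<Longrightarrow> caputo b \<theta> w t = frac_integral (\<mu> - \<theta>) \<psi> t"
    by auto
qed


subsection \<open>Caputo derivatives of products\<close>

text \<open>The mean value theorem, with the derivative largest in modulus at the left end \<sigma>.
  The bound is free of h and so supplies a majorant for the limit of difference quotients.\<close>

lemma abs_powr_diff_quotient_le:
  fixes \<sigma> h \<theta> :: real
  assumes "0 < \<sigma>" "0 < h" "0 < \<theta>"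
  shows "\<bar>((\<sigma> + h) powr -\<theta> - \<sigma> powr -\<theta>) / h\<bar> \<le> \<theta> * \<sigma> powr (-\<theta> - 1)"
proof -
  have "\<exists>z. \<sigma> < z \<and> z < \<sigma> + h \<and>
      (\<sigma> + h) powr -\<theta> - \<sigma> powr -\<theta> = (\<sigma> + h - \<sigma>) * (-\<theta> * z powr (-\<theta> - 1))"
    using assms by (intro MVT2) (auto intro!: derivative_eq_intros)
  then obtain z where z: "\<sigma> < z"
    and eq: "(\<sigma> + h) powr -\<theta> - \<sigma> powr -\<theta> = h * (-\<theta> * z powr (-\<theta> - 1))"
    by auto
  have "z powr (-\<theta> - 1) \<le> \<sigma> powr (-\<theta> - 1)"
    using assms z by (intro powr_mono2') auto
  then show ?thesis using assms unfolding eq by (auto simp: abs_mult)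
qed

lemma powr_diff_quotient_tendsto:
  fixes \<sigma> \<theta> :: real
  assumes "0 < \<sigma>" and h: "\<And>n. 0 < h n" "h \<longlonglongrightarrow> 0"
  shows "(\<lambda>n. ((\<sigma> + h n) powr -\<theta> - \<sigma> powr -\<theta>) / h n) \<longlonglongrightarrow> - (\<theta> * \<sigma> powr (-\<theta> - 1))"
proof -
  have "((\<lambda>x. x powr -\<theta>) has_real_derivative -\<theta> * \<sigma> powr (-\<theta> - 1)) (at \<sigma>)"
    using assms by (auto intro!: derivative_eq_intros)
  then have "((\<lambda>h. ((\<sigma> + h) powr -\<theta> - \<sigma> powr -\<theta>) / h) \<longlongrightarrow> -\<theta> * \<sigma> powr (-\<theta> - 1)) (at 0)"
    by (simp add: DERIV_def)
  moreover have "filterlim h (at 0) sequentially"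
    unfolding filterlim_at using h by (auto simp: less_imp_neq[THEN not_sym])
  ultimately show ?thesis by (auto dest: filterlim_compose)
qed

text \<open>Dominated convergence with majorant
  \<open>C * \<theta> * \<sigma> powr (\<mu> - \<theta> - 1)\<close>, integrable at 0 because
  \<theta> < \<mu>. Base points and kernels vary together, so the same statement gives continuity of
  the limit integral (fixed kernel) and limits of difference quotients (kernels depending on the
  step).\<close>

lemma tendsto_integral_kernel_product:
  fixes U R :: "real \<Rightarrow> real" and X :: "nat \<Rightarrow> real"
  assumes \<theta>: "0 < \<theta>" "\<theta> < \<mu>"
    and U: "continuous_on UNIV U" and R: "continuous_on UNIV R"
    and bd: "\<And>x \<sigma>. x \<in> {0..b} \<Longrightarrow> \<sigma> \<in> {0..b} \<Longrightarrow> \<bar>U (x - \<sigma>) * (R (x - \<sigma>) - R x)\<bar> \<le> C * \<sigma> powr \<mu>"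
    and b: "0 \<le> b" and X: "\<And>n. X n \<in> {0..b}" "X \<longlonglongrightarrow> x"
    and k_meas: "\<And>n. k n \<in> borel_measurable borel"
    and k_le: "\<And>n \<sigma>. 0 < \<sigma> \<Longrightarrow> \<bar>k n \<sigma>\<bar> \<le> \<theta> * \<sigma> powr (-\<theta> - 1)"
    and k_lim: "\<And>\<sigma>. 0 < \<sigma> \<Longrightarrow> (\<lambda>n. k n \<sigma>) \<longlonglongrightarrow> l \<sigma>"
  shows "(\<lambda>\<sigma>. U (X n - \<sigma>) * (R (X n - \<sigma>) - R (X n)) * k n \<sigma>) integrable_on {0..b}"
    and "(\<lambda>n. integral {0..b} (\<lambda>\<sigma>. U (X n - \<sigma>) * (R (X n - \<sigma>) - R (X n)) * k n \<sigma>))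
      \<longlonglongrightarrow> integral {0..b} (\<lambda>\<sigma>. U (x - \<sigma>) * (R (x - \<sigma>) - R x) * l \<sigma>)"
proof -
  let ?q = "\<lambda>x \<sigma>. U (x - \<sigma>) * (R (x - \<sigma>) - R x)"
  let ?h = "\<lambda>\<sigma>. C * \<theta> * \<sigma> powr (\<mu> - \<theta> - 1)"
  have h_int: "?h integrable_on {0..b}"
    using \<theta> b by (intro integrable_on_mult_right integrable_on_powr_from_0) auto
  have le: "norm (?q (X n) \<sigma> * k n \<sigma>) \<le> ?h \<sigma>" if "\<sigma> \<in> {0..b}" for n \<sigma>
  \<comment> \<open>At \<sigma> = 0 the increment of R vanishes, so nothing about the kernels is
    needed there.\<close>
  proof (cases "\<sigma> = 0")
    case False
    then have \<sigma>: "0 < \<sigma>" using that by simp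
    have "norm (?q (X n) \<sigma> * k n \<sigma>) \<le> (C * \<sigma> powr \<mu>) * (\<theta> * \<sigma> powr (-\<theta> - 1))"
      unfolding real_norm_def abs_mult[of "?q (X n) \<sigma>"]
      using bd[OF X(1)[of n] that] k_le[OF \<sigma>, of n] by (intro mult_mono) auto
    also have "\<dots> = C * \<theta> * (\<sigma> powr \<mu> * \<sigma> powr (-\<theta> - 1))" by simp
    also have "\<sigma> powr \<mu> * \<sigma> powr (-\<theta> - 1) = \<sigma> powr (\<mu> - \<theta> - 1)"
      by (simp add: powr_add[symmetric] algebra_simps)
    finally show ?thesis .
  qed simp
  have int: "(\<lambda>\<sigma>. ?q (X n) \<sigma> * k n \<sigma>) integrable_on {0..b}" for n
  proof (rule measurable_bounded_by_integrable_imp_integrable_real)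
    have "continuous_on UNIV (\<lambda>\<sigma>. ?q (X n) \<sigma>)"
      by (intro continuous_intros continuous_on_compose2[OF U] continuous_on_compose2[OF R]) auto
    then have "(\<lambda>\<sigma>. ?q (X n) \<sigma> * k n \<sigma>) \<in> borel_measurable borel"
      using k_meas[of n] by (intro borel_measurable_times[of "?q (X n)"] borel_measurable_continuous_onI[of "?q (X n)"])
    then show "(\<lambda>\<sigma>. ?q (X n) \<sigma> * k n \<sigma>) \<in> borel_measurable (lebesgue_on {0..b})"
      by (intro measurable_restrict_space1 measurable_completion) simp
  qed (use le h_int in auto)
  then show "(\<lambda>\<sigma>. ?q (X n) \<sigma> * k n \<sigma>) integrable_on {0..b}" .
  show "(\<lambda>n. integral {0..b} (\<lambda>\<sigma>. ?q (X n) \<sigma> * k n \<sigma>)) \<longlonglongrightarrow> integral {0..b} (\<lambda>\<sigma>. ?q x \<sigma> * l \<sigma>)"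
  proof (rule dominated_convergence(2)[OF int h_int])
    fix \<sigma> assume \<sigma>: "\<sigma> \<in> {0..b}"
    have *: "(\<lambda>n. f (X n - \<tau>)) \<longlonglongrightarrow> f (x - \<tau>)" if "continuous_on UNIV f" for f :: "real \<Rightarrow> real" and \<tau>
      using that X(2) by (intro isCont_tendsto_compose[where g = f] tendsto_intros)
        (auto simp: continuous_on_eq_continuous_at)
    show "(\<lambda>n. ?q (X n) \<sigma> * k n \<sigma>) \<longlonglongrightarrow> ?q x \<sigma> * l \<sigma>"
    proof (cases "\<sigma> = 0")
      case False
      then show ?thesis using \<sigma> *[OF R, of 0]
        by (intro tendsto_intros *[OF U] *[OF R] k_lim) auto
    qed simp
  qed (use le in auto)
qed

lemma frac_integral_holder_mult:
  fixes r u \<gamma> :: "real \<Rightarrow> real"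
  assumes b: "0 < b" and \<theta>: "0 < \<theta>" "\<theta> < 1" "\<theta> < \<mu>"
    and u: "continuous_on {0..b} u" "u 0 = 0" and r: "holder_on b \<mu> r"
    and \<gamma>: "continuous_on {0..b} \<gamma>"
    and G: "\<And>t. t \<in> {0..b} \<Longrightarrow> frac_integral (1 - \<theta>) u t = integral {0..t} \<gamma>"
  obtains E where "continuous_on {0..b} E" "E 0 = 0"
    "\<And>t. t \<in> {0..b} \<Longrightarrow> frac_integral (1 - \<theta>) (\<lambda>s. r s * u s) t = integral {0..t} (\<lambda>s. r s * \<gamma> s + E s)"
proof -
  have Gam: "0 < Gamma (1 - \<theta>)" using \<theta> by (intro Gamma_real_pos) auto
  have r_cont: "continuous_on {0..b} r" using holder_on_imp_continuous_on[OF _ r] \<theta> by simp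
  obtain L0 where L0: "\<And>s t. s \<in> {0..b} \<Longrightarrow> t \<in> {0..b} \<Longrightarrow> \<bar>r t - r s\<bar> \<le> L0 * \<bar>t - s\<bar> powr \<mu>"
    using r unfolding holder_on_def by blast
  \<comment> \<open>\<open>holder_on\<close> does not fix the sign of its constant; the estimates
    below need a nonnegative one.\<close>
  define L where "L = \<bar>L0\<bar>"
  have L: "0 \<le> L" "\<And>s t. s \<in> {0..b} \<Longrightarrow> t \<in> {0..b} \<Longrightarrow> \<bar>r t - r s\<bar> \<le> L * \<bar>t - s\<bar> powr \<mu>"
    using order_trans[OF L0 mult_right_mono[of L0 L]] unfolding L_def by auto
  obtain N where N: "0 \<le> N" "\<And>s. s \<in> {0..b} \<Longrightarrow> \<bar>u s\<bar> \<le> N"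
    by (rule continuous_on_bounded_abs[OF u(1)]) blast
  txt \<open>Extending the functions by constants turns the convolutions, after the substitution
    \<open>\<sigma> = x - s\<close>, into integrals over the fixed interval \<open>[0,b]\<close>, as dominated convergence in \<open>x\<close>
    requires. Since \<open>u 0 = 0\<close>, the integrand vanishes for \<open>\<sigma> > x\<close>.\<close>
  define c where "c y = max 0 (min b y)" for y :: real
  define U where "U y = u (c y)" for y
  define R where "R y = r (c y)" for y
  have c: "c y \<in> {0..b}" for y using b by (auto simp: c_def)
  have c_id: "c y = y" if "y \<in> {0..b}" for y using that by (auto simp: c_def)
  have c_cont: "continuous_on UNIV c" unfolding c_def by (intro continuous_intros)
  have U_cont: "continuous_on UNIV U" unfolding U_def
    by (rule continuous_on_compose2[OF u(1) c_cont]) (use c in auto)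
  have R_cont: "continuous_on UNIV R" unfolding R_def
    by (rule continuous_on_compose2[OF r_cont c_cont]) (use c in auto)
  have U0: "U y = 0" if "y \<le> 0" for y
    using that b u(2) by (auto simp: U_def c_def max_def min_def)
  define q where "q x \<sigma> = U (x - \<sigma>) * (R (x - \<sigma>) - R x)" for x \<sigma>
  have q0: "q x \<sigma> = 0" if "x \<le> \<sigma>" for x \<sigma> using that U0 by (simp add: q_def)
  have q_eq: "q x \<sigma> = u (x - \<sigma>) * (r (x - \<sigma>) - r x)" if "x \<in> {0..b}" "\<sigma> \<in> {0..x}" for x \<sigma>
    using that by (simp add: q_def U_def R_def c_id)
  have bd: "\<bar>U (x - \<sigma>) * (R (x - \<sigma>) - R x)\<bar> \<le> N * L * \<sigma> powr \<mu>" if "x \<in> {0..b}" "\<sigma> \<in> {0..b}" for x \<sigma>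
  proof (cases "\<sigma> \<le> x")
    case True
    have "\<bar>u (x - \<sigma>)\<bar> * \<bar>r (x - \<sigma>) - r x\<bar> \<le> N * (L * \<bar>x - \<sigma> - x\<bar> powr \<mu>)"
      using that True N L(1) by (intro mult_mono N(2) L(2)) auto
    then show ?thesis using q_eq[of x \<sigma>] that True by (simp add: q_def abs_mult)
  next
    case False
    then have "q x \<sigma> = 0" by (intro q0) auto
    then show ?thesis unfolding q_def[symmetric] using N(1) L(1) by simp
  qed
  \<comment> \<open>The derivative of \<sigma>^(-\<theta>). Integrated against \<open>q x\<close> it
    gives the correction term, up to the factor 1 / \<open>Gamma (1 - \<theta>)\<close> restored at
    the end.\<close>
  define l where "l \<sigma> = - (\<theta> * \<sigma> powr (-\<theta> - 1))" for \<sigma>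
  define E where "E x = integral {0..b} (\<lambda>\<sigma>. q x \<sigma> * l \<sigma>)" for x
  note kernel_product = tendsto_integral_kernel_product[OF \<theta>(1,3) U_cont R_cont bd less_imp_le[OF b], folded q_def]
  \<comment> \<open>The limit lemma with every kernel equal to l and only the base point
    moving.\<close>
  have E_cont: "continuous_on {0..b} E"
    unfolding continuous_on_sequentially
  proof (intro allI ballI impI, elim conjE)
    fix X x assume "\<forall>n. X n \<in> {0..b}" "X \<longlonglongrightarrow> x"
    then show "(E \<circ> X) \<longlonglongrightarrow> E x"
      unfolding o_def E_def using \<theta> by (intro kernel_product(2)) (auto simp: l_def abs_mult)
  qed
  have E0: "E 0 = 0"
  proof -
    have "E 0 = integral {0..b} (\<lambda>\<sigma>. 0)"
      unfolding E_def by (intro integral_cong) (simp add: q0)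
    then show ?thesis by simp
  qed
  define I where "I f t = integral {0..t} (\<lambda>s. (t - s) powr -\<theta> * f s)" for f :: "real \<Rightarrow> real" and t
  have frac_I: "frac_integral (1 - \<theta>) f t = I f t / Gamma (1 - \<theta>)" for f t
    by (simp add: frac_integral_def I_def)
  have kern_int: "(\<lambda>s. (t - s) powr -\<theta> * f s) integrable_on {a..t}"
    if "continuous_on {a..t} f" for a t f
    using kernel_mult_integrable[of "1 - \<theta>", OF _ that] \<theta> by simp
  define k where "k h \<sigma> = ((\<sigma> + h) powr -\<theta> - \<sigma> powr -\<theta>) / h" for h \<sigma> :: real
  have k_meas: "k h \<in> borel_measurable borel" for h unfolding k_def by measurable
  have k_le: "\<bar>k h \<sigma>\<bar> \<le> \<theta> * \<sigma> powr (-\<theta> - 1)" if "0 < h" "0 < \<sigma>" for h \<sigma>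
    using abs_powr_diff_quotient_le[OF that(2,1) \<theta>(1)] by (simp add: k_def)
  have q_int: "(\<lambda>\<sigma>. q x \<sigma> * k h \<sigma>) integrable_on {0..b}" if "x \<in> {0..b}" "0 < h" for x h
    using kernel_product(1)[of "\<lambda>_. x" x "\<lambda>_. k h"] that k_le k_meas by auto
  \<comment> \<open>The error comes from [x, x + h] alone: there r differs from r(x) by at most L
    h^\<mu>, and the kernel has mass h^(1 - \<theta>) / (1 - \<theta>); division by h leaves
    h^(\<mu> - \<theta>). The bound is uniform in x, so the base point may move together with
    h.\<close>
  have increment: "\<bar>(I (\<lambda>s. r s * u s) (x + h) - I (\<lambda>s. r s * u s) x) / h
       - (r x * ((I u (x + h) - I u x) / h) + integral {0..b} (\<lambda>\<sigma>. q x \<sigma> * k h \<sigma>))\<bar>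
     \<le> N * L / (1 - \<theta>) * h powr (\<mu> - \<theta>)"
    if x: "0 \<le> x" and h: "0 < h" and xh: "x + h \<le> b" for x h
  proof -
    define g where "g s = (r s - r x) * u s" for s
    have cont: "continuous_on {a..t} f" if "continuous_on {0..b} f" "0 \<le> a" "t \<le> b"
      for a t and f :: "real \<Rightarrow> real"
      using that by (auto elim: continuous_on_subset)
    have g_cont: "continuous_on {0..b} g"
      unfolding g_def by (intro continuous_intros r_cont u)
    have Ig: "I (\<lambda>s. r s * u s) y - r x * I u y = I g y" if "0 \<le> y" "y \<le> b" for y
    proof -
      have "integral {0..y} (\<lambda>s. (y - s) powr -\<theta> * (r s * u s)) - integral {0..y} (\<lambda>s. r x * ((y - s) powr -\<theta> * u s))
        = integral {0..y} (\<lambda>s. (y - s) powr -\<theta> * (r s * u s) - r x * ((y - s) powr -\<theta> * u s))"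
        using that by (intro integral_diff[symmetric] integrable_on_mult_right kern_int continuous_intros
            cont[OF r_cont] cont[OF u(1)]) auto
      also have "\<dots> = I g y" unfolding I_def g_def by (simp add: algebra_simps)
      finally show ?thesis by (simp add: I_def)
    qed
    have gi: "(\<lambda>s. (x + h - s) powr -\<theta> * g s) integrable_on {0..x + h}"
      using x h xh by (intro kern_int cont[OF g_cont]) auto
    then have gi': "(\<lambda>s. (x + h - s) powr -\<theta> * g s) integrable_on {0..x}"
      by (rule integrable_on_subinterval) (use h in auto)
    have gx: "(\<lambda>s. (x - s) powr -\<theta> * g s) integrable_on {0..x}"
      using x h xh by (intro kern_int cont[OF g_cont]) auto
    have "I g (x + h) - I g x = integral {0..x} (\<lambda>s. (x + h - s) powr -\<theta> * g s)
         + integral {x..x + h} (\<lambda>s. (x + h - s) powr -\<theta> * g s) - I g x"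
      unfolding I_def using Henstock_Kurzweil_Integration.integral_combine[OF x _ gi] h by simp
    also have "\<dots> = integral {0..x} (\<lambda>s. (x + h - s) powr -\<theta> * g s - (x - s) powr -\<theta> * g s)
        + integral {x..x + h} (\<lambda>s. (x + h - s) powr -\<theta> * g s)"
      unfolding I_def using integral_diff[OF gi' gx] by simp
    also have "integral {0..x} (\<lambda>s. (x + h - s) powr -\<theta> * g s - (x - s) powr -\<theta> * g s)
       = integral {0..x} (\<lambda>\<sigma>. (x + h - (x - \<sigma>)) powr -\<theta> * g (x - \<sigma>) - (x - (x - \<sigma>)) powr -\<theta> * g (x - \<sigma>))"
      by (rule integral_reflect_shift[symmetric])
    also have "\<dots> = integral {0..x} (\<lambda>\<sigma>. h * (q x \<sigma> * k h \<sigma>))"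
    proof (rule integral_cong)
      fix \<sigma> assume "\<sigma> \<in> {0..x}"
      moreover have "h * (q x \<sigma> * k h \<sigma>) = q x \<sigma> * ((\<sigma> + h) powr -\<theta> - \<sigma> powr -\<theta>)"
        using h by (simp add: k_def)
      ultimately show "(x + h - (x - \<sigma>)) powr -\<theta> * g (x - \<sigma>) - (x - (x - \<sigma>)) powr -\<theta> * g (x - \<sigma>)
          = h * (q x \<sigma> * k h \<sigma>)"
        using x h xh by (simp add: q_eq g_def algebra_simps)
    qed
    \<comment> \<open>The domain can be enlarged from [0, x] to [0, b] because \<open>q x\<close>
      vanishes beyond x.\<close>
    also have "\<dots> = h * integral {0..b} (\<lambda>\<sigma>. q x \<sigma> * k h \<sigma>)"
    proof -
      have "integral {x..b} (\<lambda>\<sigma>. q x \<sigma> * k h \<sigma>) = integral {x..b} (\<lambda>\<sigma>. 0)"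
        by (intro integral_cong) (simp add: q0)
      then show ?thesis
        using Henstock_Kurzweil_Integration.integral_combine[OF x _ q_int[of x h]] x h xh by simp
    qed
    finally have eq: "(I (\<lambda>s. r s * u s) (x + h) - I (\<lambda>s. r s * u s) x) - r x * (I u (x + h) - I u x)
       = h * integral {0..b} (\<lambda>\<sigma>. q x \<sigma> * k h \<sigma>) + integral {x..x + h} (\<lambda>s. (x + h - s) powr -\<theta> * g s)"
      using Ig[of x] Ig[of "x + h"] x h xh by (simp add: algebra_simps)
    have "\<bar>integral {x..x + h} (\<lambda>s. (x + h - s) powr ((1 - \<theta>) - 1) * g s)\<bar>
       \<le> (L * h powr \<mu> * N) * (x + h - x) powr (1 - \<theta>) / (1 - \<theta>)"
    proof (rule abs_integral_kernel_le)
      show "continuous_on {x..x + h} g" using x h xh by (intro cont[OF g_cont]) auto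
      fix s assume s: "s \<in> {x..x + h}"
      have "\<bar>r s - r x\<bar> \<le> L * \<bar>s - x\<bar> powr \<mu>" using s x h xh by (intro L) auto
      also have "\<dots> \<le> L * h powr \<mu>" using s \<theta> L(1) by (intro mult_left_mono powr_mono2) auto
      finally show "\<bar>g s\<bar> \<le> L * h powr \<mu> * N"
        unfolding g_def abs_mult using N s x xh L(1) by (intro mult_mono) auto
    qed (use \<theta> h in auto)
    also have "\<dots> = h * (N * L / (1 - \<theta>) * h powr (\<mu> - \<theta>))"
    proof -
      have "h powr \<mu> * h powr (1 - \<theta>) = h powr 1 * h powr (\<mu> - \<theta>)"
        unfolding powr_add[symmetric] by (simp add: algebra_simps)
      then show ?thesis using h by (simp add: field_simps)
    qed
    finally have rem: "\<bar>integral {x..x + h} (\<lambda>s. (x + h - s) powr -\<theta> * g s)\<bar> / h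
       \<le> N * L / (1 - \<theta>) * h powr (\<mu> - \<theta>)"
      using h by (simp add: pos_divide_le_eq mult.commute)
    have "(I (\<lambda>s. r s * u s) (x + h) - I (\<lambda>s. r s * u s) x) / h
       - (r x * ((I u (x + h) - I u x) / h) + integral {0..b} (\<lambda>\<sigma>. q x \<sigma> * k h \<sigma>))
       = ((I (\<lambda>s. r s * u s) (x + h) - I (\<lambda>s. r s * u s) x) - r x * (I u (x + h) - I u x)) / h
         - integral {0..b} (\<lambda>\<sigma>. q x \<sigma> * k h \<sigma>)"
      by (simp add: diff_divide_distrib right_diff_distrib)
    also have "\<dots> = integral {x..x + h} (\<lambda>s. (x + h - s) powr -\<theta> * g s) / h"
      unfolding eq using h by (simp add: add_divide_distrib)
    finally have "(I (\<lambda>s. r s * u s) (x + h) - I (\<lambda>s. r s * u s) x) / h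
       - (r x * ((I u (x + h) - I u x) / h) + integral {0..b} (\<lambda>\<sigma>. q x \<sigma> * k h \<sigma>))
       = integral {x..x + h} (\<lambda>s. (x + h - s) powr -\<theta> * g s) / h" .
    then show ?thesis using rem h by simp
  qed
  have G': "(I u has_real_derivative Gamma (1 - \<theta>) * \<gamma> t) (at t within {0..b})" if t: "t \<in> {0..b}" for t
    unfolding has_real_derivative_iff_has_vector_derivative
  proof (rule has_vector_derivative_transform[OF t])
    show "((\<lambda>t. Gamma (1 - \<theta>) * integral {0..t} \<gamma>) has_vector_derivative Gamma (1 - \<theta>) * \<gamma> t)
        (at t within {0..b})"
      by (intro has_vector_derivative_mult_right integral_has_vector_derivative \<gamma> t)
  qed (use G Gam in \<open>simp add: frac_I field_simps\<close>)
  have F': "(I (\<lambda>s. r s * u s) has_real_derivative r t * (Gamma (1 - \<theta>) * \<gamma> t) + E t) (at t within {0..b})"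
    if t: "t \<in> {0..b}" for t
    unfolding has_field_derivative_iff tendsto_at_iff_sequentially
  proof (intro allI impI)
    fix Y assume Y: "\<forall>n. Y n \<in> {0..b} - {t}" "Y \<longlonglongrightarrow> t"
    txt \<open>Right difference quotients at the moving base point \<open>X n\<close> cover both one-sided derivatives.\<close>
    define X where "X = (\<lambda>n. min t (Y n))"
    define h where "h = (\<lambda>n. \<bar>Y n - t\<bar>)"
    have h0: "0 < h n" for n using Y(1) by (auto simp: h_def)
    have X: "X n \<in> {0..b}" for n using Y(1) t by (auto simp: X_def min_def)
    have Xh: "0 \<le> X n" "X n + h n \<le> b" for n using Y(1) t by (auto simp: X_def h_def min_def abs_if)
    have "(\<lambda>n. min t (Y n)) \<longlonglongrightarrow> min t t" by (intro tendsto_intros Y)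
    then have X_lim: "X \<longlonglongrightarrow> t" by (simp add: X_def)
    have "(\<lambda>n. \<bar>Y n - t\<bar>) \<longlonglongrightarrow> \<bar>t - t\<bar>" by (intro tendsto_intros Y)
    then have h_lim: "h \<longlonglongrightarrow> 0" by (simp add: h_def)
    have slope: "(f (Y n) - f t) / (Y n - t) = (f (X n + h n) - f (X n)) / h n"
      for f :: "real \<Rightarrow> real" and n
      using minus_divide_divide[of "f t - f (Y n)" "t - Y n"]
      by (cases "Y n \<le> t") (auto simp: X_def h_def)
    have "((\<lambda>y. (I u y - I u t) / (y - t)) \<circ> Y) \<longlonglongrightarrow> Gamma (1 - \<theta>) * \<gamma> t"
      using G'[OF t] Y unfolding has_field_derivative_iff tendsto_at_iff_sequentially by blast
    then have G_lim: "(\<lambda>n. (I u (X n + h n) - I u (X n)) / h n) \<longlonglongrightarrow> Gamma (1 - \<theta>) * \<gamma> t"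
      unfolding o_def slope .
    have r_lim: "(\<lambda>n. r (X n)) \<longlonglongrightarrow> r t"
      using r_cont X X_lim t unfolding continuous_on_sequentially o_def by blast
    have q_lim: "(\<lambda>n. integral {0..b} (\<lambda>\<sigma>. q (X n) \<sigma> * k (h n) \<sigma>)) \<longlonglongrightarrow> E t"
      unfolding E_def
    proof (rule kernel_product(2)[OF _ _ X X_lim])
      show "(\<lambda>n. k (h n) \<sigma>) \<longlonglongrightarrow> l \<sigma>" if "0 < \<sigma>" for \<sigma>
        using powr_diff_quotient_tendsto[OF that h0 h_lim] by (simp add: k_def l_def)
    qed (use k_meas k_le h0 in auto)
    have "(\<lambda>n. N * L / (1 - \<theta>) * h n powr (\<mu> - \<theta>)) \<longlonglongrightarrow> N * L / (1 - \<theta>) * 0 powr (\<mu> - \<theta>)"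
      using h0 \<theta> by (intro tendsto_intros tendsto_powr'[OF h_lim]) (auto simp: less_imp_le)
    then have "(\<lambda>n. N * L / (1 - \<theta>) * h n powr (\<mu> - \<theta>)) \<longlonglongrightarrow> 0" by simp
    then have "(\<lambda>n. (I (\<lambda>s. r s * u s) (X n + h n) - I (\<lambda>s. r s * u s) (X n)) / h n
       - (r (X n) * ((I u (X n + h n) - I u (X n)) / h n) + integral {0..b} (\<lambda>\<sigma>. q (X n) \<sigma> * k (h n) \<sigma>))) \<longlonglongrightarrow> 0"
      by (rule Lim_null_comparison[rotated])
        (intro always_eventually allI, unfold real_norm_def, rule increment[OF Xh(1) h0 Xh(2)])
    from tendsto_add[OF this tendsto_add[OF tendsto_mult[OF r_lim G_lim] q_lim]]
    show "((\<lambda>y. (I (\<lambda>s. r s * u s) y - I (\<lambda>s. r s * u s) t) / (y - t)) \<circ> Y)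
        \<longlonglongrightarrow> r t * (Gamma (1 - \<theta>) * \<gamma> t) + E t"
      unfolding o_def slope by simp
  qed
  show thesis
  \<comment> \<open>The operator \<open>I\<close> omits the normalisation 1 /
    \<open>Gamma (1 - \<theta>)\<close> of the fractional integral; the witness puts it
    back.\<close>
  proof (rule that[of "\<lambda>t. E t / Gamma (1 - \<theta>)"])
    show "continuous_on {0..b} (\<lambda>t. E t / Gamma (1 - \<theta>))"
      using Gam by (intro continuous_intros E_cont) auto
    fix t assume t: "t \<in> {0..b}"
    have "((\<lambda>s. r s * (Gamma (1 - \<theta>) * \<gamma> s) + E s) has_integral
        (I (\<lambda>s. r s * u s) t - I (\<lambda>s. r s * u s) 0)) {0..t}"
    proof (rule fundamental_theorem_of_calculus)
      fix x assume "x \<in> {0..t}"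
      then show "(I (\<lambda>s. r s * u s) has_vector_derivative r x * (Gamma (1 - \<theta>) * \<gamma> x) + E x) (at x within {0..t})"
        using F'[of x] t unfolding has_real_derivative_iff_has_vector_derivative
        by (auto elim!: has_vector_derivative_within_subset)
    qed (use t in auto)
    from has_integral_mult_right[OF this, of "1 / Gamma (1 - \<theta>)"] Gam
    have "((\<lambda>s. r s * \<gamma> s + E s / Gamma (1 - \<theta>)) has_integral
        frac_integral (1 - \<theta>) (\<lambda>s. r s * u s) t) {0..t}"
      by (simp add: frac_I I_def field_simps)
    then show "frac_integral (1 - \<theta>) (\<lambda>s. r s * u s) t = integral {0..t} (\<lambda>s. r s * \<gamma> s + E s / Gamma (1 - \<theta>))"
      by (simp add: integral_unique)
  qed (simp add: E0)
qed

text \<open>Decompose r v - r(0) v(0) = r (v - v(0)) + v(0) (r - r(0)). The first product has a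
  factor vanishing at 0, as the preceding lemma requires; the second is a constant multiple of an
  increment of r. The correction term drops out at 0.\<close>

lemma caputo_mult:
  assumes b: "0 < b" and \<theta>: "0 < \<theta>" "\<theta> < 1" "\<theta> < \<mu>"
    and v: "continuous_on {0..b} v" "caputo_continuous b \<theta> v"
    and r: "holder_on b \<mu> r" "caputo_continuous b \<theta> r"
  shows "caputo_continuous b \<theta> (\<lambda>s. r s * v s)"
    and "caputo b \<theta> (\<lambda>s. r s * v s) 0 = r 0 * caputo b \<theta> v 0 + v 0 * caputo b \<theta> r 0"
proof -
  have r_cont: "continuous_on {0..b} r" using holder_on_imp_continuous_on[OF _ r(1)] \<theta> by simp
  have D: "continuous_on {0..b} (caputo b \<theta> v)" "continuous_on {0..b} (caputo b \<theta> r)"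
    using v r by (auto simp: caputo_continuous_def)
  have u: "continuous_on {0..b} (\<lambda>s. v s - v 0)" by (intro continuous_intros v)
  obtain E where E: "continuous_on {0..b} E" "E 0 = 0"
    and eq: "\<And>t. t \<in> {0..b} \<Longrightarrow> frac_integral (1 - \<theta>) (\<lambda>s. r s * (v s - v 0)) t
      = integral {0..t} (\<lambda>s. r s * caputo b \<theta> v s + E s)"
    using frac_integral_holder_mult[OF b \<theta> u _ r(1) D(1) frac_integral_caputo_continuous[OF b \<theta>(1,2) v]]
    by auto
  define \<phi> where "\<phi> s = (r s * caputo b \<theta> v s + E s) + v 0 * caputo b \<theta> r s" for s
  have \<phi>: "continuous_on {0..b} \<phi>"
    unfolding \<phi>_def by (intro continuous_intros r_cont D E)
  have *: "frac_integral (1 - \<theta>) (\<lambda>s. r s * v s - r 0 * v 0) t = integral {0..t} \<phi>" if t: "t \<in> {0..b}" for t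
  proof -
    have sub: "{0..t} \<subseteq> {0..b}" using t by auto
    note cont = continuous_on_subset[OF _ sub]
    have "frac_integral (1 - \<theta>) (\<lambda>s. r s * v s - r 0 * v 0) t
        = frac_integral (1 - \<theta>) (\<lambda>s. r s * (v s - v 0) + v 0 * (r s - r 0)) t"
      by (simp add: algebra_simps)
    also have "\<dots> = frac_integral (1 - \<theta>) (\<lambda>s. r s * (v s - v 0)) t + frac_integral (1 - \<theta>) (\<lambda>s. v 0 * (r s - r 0)) t"
      using \<theta> by (intro frac_integral_plus continuous_intros cont[OF r_cont] cont[OF v(1)]) auto
    also have "\<dots> = integral {0..t} (\<lambda>s. r s * caputo b \<theta> v s + E s) + integral {0..t} (\<lambda>s. v 0 * caputo b \<theta> r s)"
      using eq[OF t] frac_integral_caputo_continuous[OF b \<theta>(1,2) r_cont r(2) t]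
      by (simp add: frac_integral_mult_right)
    also have "\<dots> = integral {0..t} \<phi>"
      unfolding \<phi>_def
      by (intro integral_add[symmetric] integrable_continuous_real continuous_intros
          cont[OF r_cont] cont[OF D(1)] cont[OF D(2)] cont[OF E(1)])
    finally show ?thesis .
  qed
  from caputo_eqI[OF b \<theta>(2) \<phi>, of "\<lambda>s. r s * v s", OF *] E(2) b
  show "caputo_continuous b \<theta> (\<lambda>s. r s * v s)"
    and "caputo b \<theta> (\<lambda>s. r s * v s) 0 = r 0 * caputo b \<theta> v 0 + v 0 * caputo b \<theta> r 0"
    by (auto simp: \<phi>_def)
qed


subsection \<open>Hoelder and asymptotic properties\<close>

lemma holder_on_if_increment:
  assumes "holder_on b a g" "\<And>t. t \<in> {0..b} \<Longrightarrow> f t - f 0 = g t"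
  shows "holder_on b a f"
proof -
  have "\<bar>f t - f s\<bar> = \<bar>g t - g s\<bar>" if "s \<in> {0..b}" "t \<in> {0..b}" for s t
    using assms(2)[OF that(1)] assms(2)[OF that(2)] by (simp flip: assms(2))
  then show ?thesis using assms(1) unfolding holder_on_def by simp
qed

text \<open>Presents continuously differentiable coefficients as the case of order 1, to which
  \<open>caputo_frac_integral\<close> applies.\<close>

lemma C1_on_imp_frac_integral:
  assumes "C1_on b f"
  obtains f' where "continuous_on {0..b} f'" "\<And>t. t \<in> {0..b} \<Longrightarrow> f t - f 0 = frac_integral 1 f' t"
proof -
  obtain f' where f': "continuous_on {0..b} f'"
    and d: "\<And>t. t \<in> {0..b} \<Longrightarrow> (f has_real_derivative f' t) (at t within {0..b})"
    using assms unfolding C1_on_def by blast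
  have "f t - f 0 = frac_integral 1 f' t" if t: "t \<in> {0..b}" for t
  proof -
    have "(f' has_integral f t - f 0) {0..t}"
    proof (rule fundamental_theorem_of_calculus)
      fix x assume "x \<in> {0..t}"
      then show "(f has_vector_derivative f' x) (at x within {0..t})"
        using d[of x] t unfolding has_real_derivative_iff_has_vector_derivative
        by (auto elim!: has_vector_derivative_within_subset)
    qed (use t in auto)
    then show ?thesis by (simp add: frac_integral_1 integral_unique)
  qed
  with f' show thesis by (rule that)
qed

text \<open>Subtract the constant f(0), whose fractional integral is explicit. By continuity the
  remainder has small sup norm on [0, t], and its fractional integral is a small multiple of
  t^a.\<close>

lemma frac_integral_asymptotics:
  assumes b: "0 < b" and a: "0 < a" and f: "continuous_on {0..b} f"
  shows "((\<lambda>t. frac_integral a f t / t powr a) \<longlongrightarrow> f 0 / Gamma (1 + a)) (at_right 0)"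
proof (rule tendstoI)
  fix e :: real assume e: "0 < e"
  have G: "0 < Gamma (1 + a)" using a by (intro Gamma_real_pos) auto
  \<comment> \<open>The Gamma factor cancels the denominator in \<open>abs_frac_integral_le\<close>;
    the half makes the final inequality strict.\<close>
  define e' where "e' = e * Gamma (1 + a) / 2"
  have e': "0 < e'" using e G by (simp add: e'_def)
  obtain d where d: "0 < d" "\<And>s. s \<in> {0..b} \<Longrightarrow> \<bar>s\<bar> < d \<Longrightarrow> \<bar>f s - f 0\<bar> < e'"
    using f[unfolded continuous_on_iff, rule_format, of 0 e'] b e' by (auto simp: dist_real_def)
  have "dist (frac_integral a f t / t powr a) (f 0 / Gamma (1 + a)) < e" if t: "0 < t" "t < min b d" for t
  proof -
    have ft: "continuous_on {0..t} f" using f t by (auto elim: continuous_on_subset)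
    have "frac_integral a (\<lambda>s. f s - f 0) t = frac_integral a f t - f 0 * t powr a / Gamma (1 + a)"
      using a t ft by (simp add: frac_integral_diff frac_integral_const)
    moreover have "\<bar>frac_integral a (\<lambda>s. f s - f 0) t\<bar> \<le> e' * t powr a / Gamma (1 + a)"
      using a t d(2) by (intro abs_frac_integral_le continuous_intros ft) (auto simp: less_imp_le)
    moreover have "frac_integral a f t / t powr a - f 0 / Gamma (1 + a)
        = (frac_integral a f t - f 0 * t powr a / Gamma (1 + a)) / t powr a"
      using t by (simp add: diff_divide_distrib)
    ultimately have "\<bar>frac_integral a f t / t powr a - f 0 / Gamma (1 + a)\<bar> \<le> e' / Gamma (1 + a)"
      using t by (simp add: pos_divide_le_eq)
    also have "\<dots> < e" using e G by (simp add: e'_def)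
    finally show ?thesis by (simp add: dist_real_def)
  qed
  then show "\<forall>\<^sub>F t in at_right 0. dist (frac_integral a f t / t powr a) (f 0 / Gamma (1 + a)) < e"
    using b d(1) by (intro eventually_at_rightI[of 0 "min b d"]) auto
qed

text \<open>The integral of w is the fractional integral of order 1 + a of f, so the quotient
  compares two known asymptotics. Their constants have ratio Gamma(2 + a) / Gamma(1 + a) = 1 + a,
  and f(0) \<noteq> 0 permits the division.\<close>

lemma frac_integral_ratio_limit:
  assumes b: "0 < b" and a: "0 < a" "a \<le> 1" and f: "continuous_on {0..b} f" "f 0 \<noteq> 0"
    and w: "\<And>t. t \<in> {0..b} \<Longrightarrow> w t = frac_integral a f t"
  shows "((\<lambda>t. t * w t / integral {0..t} w - 1) \<longlongrightarrow> a) (at_right 0)"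
proof -
  have G: "0 < Gamma (1 + a)" using a by (intro Gamma_real_pos) auto
  have G': "Gamma (1 + (1 + a)) = (1 + a) * Gamma (1 + a)"
    using Gamma_plus1[of "1 + a"] a by (auto simp: add.commute nonpos_Ints_def)
  have "((\<lambda>t. (frac_integral a f t / t powr a) / (frac_integral (1 + a) f t / t powr (1 + a)) - 1)
      \<longlongrightarrow> (f 0 / Gamma (1 + a)) / (f 0 / Gamma (1 + (1 + a))) - 1) (at_right 0)"
  proof (rule tendsto_diff[OF tendsto_divide tendsto_const])
    show "((\<lambda>t. frac_integral a f t / t powr a) \<longlongrightarrow> f 0 / Gamma (1 + a)) (at_right 0)"
      by (rule frac_integral_asymptotics[OF b a(1) f(1)])
    show "((\<lambda>t. frac_integral (1 + a) f t / t powr (1 + a)) \<longlongrightarrow> f 0 / Gamma (1 + (1 + a))) (at_right 0)"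
      using a by (intro frac_integral_asymptotics[OF b _ f(1)]) auto
    have "0 < Gamma (1 + (1 + a))" using a by (intro Gamma_real_pos) auto
    with f(2) show "f 0 / Gamma (1 + (1 + a)) \<noteq> 0" by (metis divide_eq_0_iff less_irrefl)
  qed
  also have "(f 0 / Gamma (1 + a)) / (f 0 / Gamma (1 + (1 + a))) - 1 = a"
    unfolding G' using G f(2) by simp
  finally show ?thesis
  proof (rule Lim_transform_eventually)
    show "\<forall>\<^sub>F t in at_right 0. (frac_integral a f t / t powr a) / (frac_integral (1 + a) f t / t powr (1 + a)) - 1
        = t * w t / integral {0..t} w - 1"
    proof (rule eventually_at_rightI[of 0 b])
      fix t assume t: "t \<in> {0<..<b}"
      have "integral {0..t} w = frac_integral 1 (frac_integral a f) t"
        unfolding frac_integral_1 using w t by (intro integral_cong) auto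
      also have "\<dots> = frac_integral (1 + a) f t"
        using a t continuous_on_subset[OF f(1), of "{0..t}"] by (intro frac_integral_add) auto
      finally show "(frac_integral a f t / t powr a) / (frac_integral (1 + a) f t / t powr (1 + a)) - 1
          = t * w t / integral {0..t} w - 1"
        using w[of t] t by (simp add: powr_add)
    qed (rule b)
  qed
qed

section \<open>Leading order and representation of the product near 0\<close>

text \<open>The first conjunct of the conclusion records that the derivatives of \<open>r i\<close>
  and of the products are continuous up to 0, so the values at 0, written with \<open>Lim\<close>,
  are genuine limits. They are limits from the right, hence the same whether derivatives are taken
  within [0, \<open>Ts\<close>] or [0, \<open>T\<close>].\<close>

theorem theorem3p2:
  fixes T Ts \<nu>s :: real and M :: nat and \<nu> :: "nat \<Rightarrow> real"
    and r :: "nat \<Rightarrow> real \<Rightarrow> real" and v :: "real \<Rightarrow> real"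
  assumes "0 < T" and "1 \<le> M"
    and "0 < \<nu> M" and "\<forall>i<M. \<nu> (Suc i) < \<nu> i" and "\<nu> 0 < 1"
    and "0 < Ts" and "Ts \<le> T" and "0 < \<nu>s" and "\<nu>s < 1"
    and v_T: "continuous_on {0..T} v" "\<forall>i\<le>M. caputo_continuous T (\<nu> i) v"
    and v_Ts: "caputo_holder Ts (\<nu> 0) \<nu>s v" "\<forall>i\<le>M. holder_on Ts \<nu>s (caputo Ts (\<nu> i) v)"
    and r_T: "\<forall>i\<le>M. continuous_on {0..T} (r i)" "\<forall>t\<in>{0..T}. r 0 t \<noteq> 0"
    and r_Ts: "\<forall>i\<le>M.
        C1_on Ts (r i)
      \<or> (\<nu>s + \<nu> i < 1 \<and>
          (\<exists>\<mu> \<mu>s. \<nu>s + \<nu> i < \<mu> \<and> \<mu> < 1 \<and> 0 < \<mu>s \<and> \<mu>s < 1 \<and>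
             holder_on Ts \<mu> (r i) \<and> caputo_holder Ts (\<nu> i) \<mu>s (r i)))
      \<or> (1 \<le> \<nu>s + \<nu> i \<and> \<nu>s + \<nu> i < 2 \<and>
          (\<exists>\<mu> \<mu>s \<mu>1. \<nu> i < \<mu> \<and> \<mu> < 1 \<and> 0 < \<mu>s \<and> \<mu>s < 1 \<and> 0 < \<mu>1 \<and> \<mu>1 < 1 \<and>
             caputo_holder Ts \<mu> \<mu>s (r i) \<and>
             caputo_continuous Ts (\<nu> i) (r i) \<and> holder_on Ts \<mu>1 (caputo Ts (\<nu> i) (r i))))"
    and nonzero: "frac_op_II Ts M \<nu> r v 0 - v 0 * (\<Sum>i=1..M. caputo Ts (\<nu> i) (r i) 0) \<noteq> 0"
  shows "(\<forall>i\<le>M. caputo_continuous Ts (\<nu> i) (r i) \<and>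
                caputo_continuous Ts (\<nu> i) (\<lambda>s. r i s * v s))
    \<and> ((\<lambda>t. t * (r 0 t * v t - r 0 0 * v 0) /
              integral {0..t} (\<lambda>\<tau>. r 0 \<tau> * v \<tau> - r 0 0 * v 0) - 1)
         \<longlongrightarrow> \<nu> 0) (at_right 0)
    \<and> (let C1 = (frac_op_II Ts M \<nu> r v 0 - v 0 * (\<Sum>i=1..M. caputo Ts (\<nu> i) (r i) 0))
                 / Gamma (1 + \<nu> 0)
       in \<forall>t\<in>{0..Ts}. r 0 t * v t = r 0 0 * v 0 + C1 * t powr \<nu> 0
            + 1 / Gamma (\<nu> 0) *
              integral {0..t} (\<lambda>\<tau>. (t - \<tau>) powr (\<nu> 0 - 1) *
                (caputo Ts (\<nu> 0) (\<lambda>s. r 0 s * v s) \<tau> - caputo Ts (\<nu> 0) (\<lambda>s. r 0 s * v s) 0)))"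
proof -
  have Ts: "0 < Ts" by fact
  have dec: "\<nu> j < \<nu> i" if "i < j" "j \<le> M" for i j
    using that
  proof (induction j)
    case (Suc j)
    have "\<nu> (Suc j) < \<nu> j" using assms(4) Suc.prems by simp
    moreover have "\<nu> j \<le> \<nu> i" using Suc by (cases "i = j") auto
    ultimately show ?case by simp
  qed simp
  have \<nu>: "0 < \<nu> i" "\<nu> i < 1" if "i \<le> M" for i
    using dec[of i M] dec[of 0 i] that assms(3,5) by (cases "i = M"; cases "i = 0"; force)+
  have v: "continuous_on {0..Ts} v" "caputo_continuous Ts (\<nu> 0) v"
    using v_Ts(1) by (auto simp: caputo_holder_def)
  \<comment> \<open>As v - v(0) is a fractional integral of order \<open>\<nu> 0\<close>, its
    derivative of lower order \<open>\<nu> i\<close> is a fractional integral of the positive order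
    \<open>\<nu> 0 - \<nu> i\<close>, which is 0 at 0.\<close>
  have v_lower: "caputo_continuous Ts (\<nu> i) v" "caputo Ts (\<nu> i) v 0 = 0" if "1 \<le> i" "i \<le> M" for i
  proof -
    have "v t - v 0 = frac_integral (\<nu> 0) (caputo Ts (\<nu> 0) v) t" if "t \<in> {0..Ts}" for t
      using \<nu>[of 0] by (intro caputo_imp_frac_integral Ts v that) auto
    moreover have "continuous_on {0..Ts} (caputo Ts (\<nu> 0) v)"
      using v(2) by (simp add: caputo_continuous_def)
    ultimately
    show "caputo_continuous Ts (\<nu> i) v" "caputo Ts (\<nu> i) v 0 = 0"
      using caputo_frac_integral[OF Ts, of "\<nu> i" "\<nu> 0" "caputo Ts (\<nu> 0) v" v]
        \<nu>[of i] \<nu>[of 0] dec[of 0 i] that Ts by auto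
  qed
  have v_all: "caputo_continuous Ts (\<nu> i) v" if "i \<le> M" for i
    using v_lower(1)[of i] v(2) that by (cases "i = 0") auto
  \<comment> \<open>The exponent above \<open>\<nu> i\<close> is 1 in the first class and the given
    \<mu> in the second. In the third it is the order \<mu> of the continuous Caputo derivative,
    since the increment of \<open>r i\<close> is then a fractional integral of order \<mu>.\<close>
  have r: "caputo_continuous Ts (\<nu> i) (r i) \<and> (\<exists>\<mu>>\<nu> i. holder_on Ts \<mu> (r i))" if i: "i \<le> M" for i
    using r_Ts[rule_format, OF i]
  proof (elim disjE conjE exE)
    assume "C1_on Ts (r i)"
    then obtain f where f: "continuous_on {0..Ts} f"
      "\<And>t. t \<in> {0..Ts} \<Longrightarrow> r i t - r i 0 = frac_integral 1 f t"
      by (rule C1_on_imp_frac_integral) blast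
    have "holder_on Ts 1 (r i)"
      by (rule holder_on_if_increment[OF holder_on_frac_integral[OF _ _ f(1)] f(2)]) auto
    then show ?thesis
      using caputo_frac_integral(1)[OF Ts \<nu>[OF i] order_refl f] \<nu>[OF i] by auto
  next
    fix \<mu> \<mu>s
    assume "\<nu>s + \<nu> i < \<mu>" "holder_on Ts \<mu> (r i)" "caputo_holder Ts (\<nu> i) \<mu>s (r i)"
    then show ?thesis
      using assms(8) by (auto simp: caputo_holder_def intro!: exI[of _ \<mu>])
  next
    fix \<mu> \<mu>s
    assume \<mu>: "\<nu> i < \<mu>" "\<mu> < 1" and ch: "caputo_holder Ts \<mu> \<mu>s (r i)"
      and cc: "caputo_continuous Ts (\<nu> i) (r i)"
    have r\<mu>: "continuous_on {0..Ts} (r i)" "caputo_continuous Ts \<mu> (r i)"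
      using ch by (auto simp: caputo_holder_def)
    then have "continuous_on {0..Ts} (caputo Ts \<mu> (r i))" by (simp add: caputo_continuous_def)
    then have "holder_on Ts \<mu> (frac_integral \<mu> (caputo Ts \<mu> (r i)))"
      using \<mu> \<nu>[OF i] by (intro holder_on_frac_integral) auto
    then have "holder_on Ts \<mu> (r i)"
    proof (rule holder_on_if_increment)
      show "r i t - r i 0 = frac_integral \<mu> (caputo Ts \<mu> (r i)) t" if "t \<in> {0..Ts}" for t
        using \<mu> \<nu>[OF i] by (intro caputo_imp_frac_integral Ts r\<mu> that) auto
    qed
    then show ?thesis using cc \<mu> by auto
  qed
  have rv: "caputo_continuous Ts (\<nu> i) (\<lambda>s. r i s * v s)"
    "caputo Ts (\<nu> i) (\<lambda>s. r i s * v s) 0 = r i 0 * caputo Ts (\<nu> i) v 0 + v 0 * caputo Ts (\<nu> i) (r i) 0"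
    if i: "i \<le> M" for i
  proof -
    obtain \<mu> where \<mu>: "\<nu> i < \<mu>" "holder_on Ts \<mu> (r i)" using r[OF i] by blast
    from caputo_mult[OF Ts \<nu>[OF i] \<mu>(1) v(1) v_all[OF i] \<mu>(2) conjunct1[OF r[OF i]]]
    show "caputo_continuous Ts (\<nu> i) (\<lambda>s. r i s * v s)"
      "caputo Ts (\<nu> i) (\<lambda>s. r i s * v s) 0 = r i 0 * caputo Ts (\<nu> i) v 0 + v 0 * caputo Ts (\<nu> i) (r i) 0" .
  qed
  define \<Phi> where "\<Phi> = caputo Ts (\<nu> 0) (\<lambda>s. r 0 s * v s)"
  have \<nu>0: "0 < \<nu> 0" "\<nu> 0 < 1" using \<nu>[of 0] by auto
  have \<Phi>: "continuous_on {0..Ts} \<Phi>" using rv(1)[of 0] by (simp add: \<Phi>_def caputo_continuous_def)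
  \<comment> \<open>Only i = 0 keeps the term with the derivative of v. For i \<ge> 1 that
    derivative is 0 at 0, so the product rule leaves exactly the sum subtracted in the
    hypothesis.\<close>
  have "frac_op_II Ts M \<nu> r v 0 = \<Phi> 0 + (\<Sum>i=1..M. caputo Ts (\<nu> i) (\<lambda>s. r i s * v s) 0)"
    unfolding frac_op_II_def \<Phi>_def by (simp add: sum.atLeast_Suc_atMost)
  also have "(\<Sum>i=1..M. caputo Ts (\<nu> i) (\<lambda>s. r i s * v s) 0) = v 0 * (\<Sum>i=1..M. caputo Ts (\<nu> i) (r i) 0)"
    unfolding sum_distrib_left by (intro sum.cong refl) (simp add: rv(2) v_lower(2))
  finally have \<Phi>0: "frac_op_II Ts M \<nu> r v 0 - v 0 * (\<Sum>i=1..M. caputo Ts (\<nu> i) (r i) 0) = \<Phi> 0"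
    by simp
  have "continuous_on {0..Ts} (\<lambda>s. r 0 s * v s)"
    using continuous_on_subset[of "{0..T}" "r 0" "{0..Ts}"] r_T(1) assms(7)
    by (intro continuous_on_mult v(1)) auto
  \<comment> \<open>Abel inversion for the product \<open>r 0\<close> v; both remaining claims are
    read off from this representation.\<close>
  from caputo_imp_frac_integral[OF Ts \<nu>0 this rv(1)[of 0]]
  have rep: "r 0 t * v t - r 0 0 * v 0 = frac_integral (\<nu> 0) \<Phi> t" if "t \<in> {0..Ts}" for t
    using that by (simp add: \<Phi>_def)
  have "((\<lambda>t. t * (r 0 t * v t - r 0 0 * v 0) /
              integral {0..t} (\<lambda>\<tau>. r 0 \<tau> * v \<tau> - r 0 0 * v 0) - 1) \<longlongrightarrow> \<nu> 0) (at_right 0)"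
    using nonzero \<nu>0 unfolding \<Phi>0 by (intro frac_integral_ratio_limit[OF Ts _ _ \<Phi> _ rep]) auto
  moreover have "r 0 t * v t = r 0 0 * v 0 + \<Phi> 0 / Gamma (1 + \<nu> 0) * t powr \<nu> 0
            + 1 / Gamma (\<nu> 0) * integral {0..t} (\<lambda>\<tau>. (t - \<tau>) powr (\<nu> 0 - 1) * (\<Phi> \<tau> - \<Phi> 0))"
    if t: "t \<in> {0..Ts}" for t
  proof -
    \<comment> \<open>Splitting off the constant \<open>\<Phi> 0\<close> produces the term in
      t^\<open>\<nu> 0\<close>, with coefficient
      \<open>\<Phi> 0 / Gamma (1 + \<nu> 0)\<close>.\<close>
    have "continuous_on {0..t} \<Phi>" using \<Phi> t by (auto elim: continuous_on_subset)
    then have "frac_integral (\<nu> 0) (\<lambda>\<tau>. \<Phi> \<tau> - \<Phi> 0) t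
        = frac_integral (\<nu> 0) \<Phi> t - \<Phi> 0 * t powr \<nu> 0 / Gamma (1 + \<nu> 0)"
      using \<nu>0 t by (simp add: frac_integral_diff frac_integral_const)
    then show ?thesis using rep[OF t] by (simp add: frac_integral_def[of _ "\<lambda>\<tau>. \<Phi> \<tau> - \<Phi> 0"])
  qed
  ultimately show ?thesis
    using r rv(1) unfolding Let_def \<Phi>0 \<Phi>_def[symmetric] by blast
qed

end
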